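(* Let $n>0$ and $\nu\in MZ(n)$. If $P\in\Pi_{n/2}$, then $\sigma_n(\nu;P)=P$. If $1\le p\le\infty$ and $f\in L^p$, then $$E_{n,p}(f)\le\|\sigma_n(\nu;f)-f\|_p\le c\,E_{n/2,p}(f).$$
   Context: Notation. $\mathbb{B}(x,r)=[x-r,x+r]$; $L^p=L^p(\mathbb{R})$ and $\|\cdot\|_p$ are taken with respect to Lebesgue measure. $c$ denotes a generic positive constant depending only on the fixed parameters in the discussion, such as the norms, smoothness parameters, etc., and possibly on the filter $h$ below. Hermite functions: $\psi_j(x)=\frac{(-1)^j}{\pi^{1/4}2^{j/2}\sqrt{j!}}\exp(x^2/2)\left(\frac{d}{dx}\right)^j(\exp(-x^2))$, $j=0,1,\dots$; these are orthonormal in $L^2(\mathbb{R})$. For $t>0$, $\Pi_t=\mathrm{span}\{\psi_j:\sqrt{j}<t\}$, equivalently the set of functions $\exp(-x^2/2)P(x)$ with $P$ an algebraic polynomial of degree $<t^2$. For $f\in L^p$, $E_{t,p}(f)=\inf_{Q\in\Pi_t}\|f-Q\|_p$. Measures: a measure means a signed, complex valued Borel measure, or a positive sigma-finite Borel measure, on $\mathbb{R}$; $|\nu|$ denotes total variation. For $t>0$, $|\!|\!|\nu|\!|\!|_t=\sup_{x\in\mathbb{R},\,r>0}\frac{|\nu|(\mathbb{B}(x,r))}{r+1/t}$ and $\mathcal{R}_t=\{\nu:|\!|\!|\nu|\!|\!|_t<\infty\}$. For $n>0$, $MZ(n)$ is the set of $\nu\in\mathcal{R}_n$ such that $\int_{\mathbb{R}}P(y)Q(y)\,dy=\int_{\mathbb{R}}P(y)Q(y)\,d\nu(y)$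 for all $P,Q\in\Pi_n$. Fix a low pass filter $h$: an even, infinitely differentiable function $h:\mathbb{R}\to[0,1]$ with $h(u)=1$ for $|u|\le 1/2$, $h$ non-increasing on $[1/2,1]$, and $h(u)=0$ for $|u|\ge 1$. For $n>0$ let $\Phi_n(x,y)=\sum_{j=0}^\infty h(\sqrt{j}/n)\psi_j(x)\psi_j(y)$ and, for a Borel measure $\nu$ and $f\in L^1(\nu)+L^\infty$, $\sigma_n(\nu;f,x)=\int_{\mathbb{R}}\Phi_n(x,y)f(y)\,d\nu(y)$.
   Formalization: The upper bound is false for general ν (e.g. ν=√π·δ_0, f=1_{0}); it is proved when |||ν|||_{max(1,n)} ≤ M and the L^p(|ν|) norm of f−Q is at most K‖f−Q‖_p for all Q in Π_{n/2}, with c depending on h,p,M,K; f is a Borel function in L^p and in L^1(ν)+L^∞(|ν|). *)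

theory Defs
  imports "HOL-Analysis.Analysis" "HOL-Probability.Essential_Supremum"
begin

(* All functions and coefficients are complex valued; real data are a special case. *)

definition hermite_fn :: "nat \<Rightarrow> real \<Rightarrow> real" where
  "hermite_fn j x =
     (-1) ^ j / (pi powr (1/4) * 2 powr (real j / 2) * sqrt (fact j))
       * exp (x\<^sup>2 / 2) * (deriv ^^ j) (\<lambda>u. exp (- u\<^sup>2)) x"

definition hermite_space :: "real \<Rightarrow> (real \<Rightarrow> complex) set" where
  "hermite_space t =
     {Q. \<exists>a :: nat \<Rightarrow> complex.
           Q = (\<lambda>x. \<Sum>j\<in>{j. sqrt (real j) < t}. a j * complex_of_real (hermite_fn j x))}"

definition Lp_norm :: "real measure \<Rightarrow> ennreal \<Rightarrow> (real \<Rightarrow> complex) \<Rightarrow> ennreal" where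
  "Lp_norm M p f =
     (if p = \<infinity> then esssup M (\<lambda>x. ennreal (cmod (f x)))
      else (let I = (\<integral>\<^sup>+x. ennreal (cmod (f x) powr enn2real p) \<partial>M)
            in if I = \<infinity> then \<infinity> else ennreal (enn2real I powr (1 / enn2real p))))"

(* Elements are functions, not classes modulo null sets: they also get integrated against
   Borel measures that are singular with respect to Lebesgue measure. *)
definition Lp_space :: "real measure \<Rightarrow> ennreal \<Rightarrow> (real \<Rightarrow> complex) set" where
  "Lp_space M p = {f \<in> borel_measurable M. Lp_norm M p f < \<infinity>}"

definition approx_error :: "real \<Rightarrow> ennreal \<Rightarrow> (real \<Rightarrow> complex) \<Rightarrow> ennreal" where
  "approx_error t p f = (INF Q\<in>hermite_space t. Lp_norm lborel p (\<lambda>x. f x - Q x))"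


(* A complex measure is a countably additive set function on the Borel sets (a finite signed
   measure is one with real values); infinite values only occur for positive measures. *)
datatype line_measure =
    Complex_Measure "real set \<Rightarrow> complex"
  | Positive_Measure "real measure"

definition countably_additive_complex :: "(real set \<Rightarrow> complex) \<Rightarrow> bool" where
  "countably_additive_complex \<mu> \<longleftrightarrow>
     (\<forall>A :: nat \<Rightarrow> real set. range A \<subseteq> sets borel \<longrightarrow> disjoint_family A \<longrightarrow>
        (\<lambda>i. \<mu> (A i)) sums \<mu> (\<Union>i. A i))"

primrec is_line_measure :: "line_measure \<Rightarrow> bool" where
  "is_line_measure (Complex_Measure \<mu>) = countably_additive_complex \<mu>"
| "is_line_measure (Positive_Measure M) = (sets M = sets borel \<and> sigma_finite_measure M)"

primrec variation :: "line_measure \<Rightarrow> real measure" where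
  "variation (Complex_Measure \<mu>) =
     measure_of UNIV (sets borel)
       (\<lambda>A. SUP F\<in>{F :: nat \<Rightarrow> real set.
                      range F \<subseteq> sets borel \<and> disjoint_family F \<and> (\<Union>i. F i) = A}.
              \<Sum>i. ennreal (cmod (\<mu> (F i))))"
| "variation (Positive_Measure M) = M"

(* Positive part in the Jordan decomposition of a finite signed measure. *)
definition jordan_pos :: "(real set \<Rightarrow> real) \<Rightarrow> real measure" where
  "jordan_pos \<rho> =
     measure_of UNIV (sets borel) (\<lambda>A. SUP B\<in>{B \<in> sets borel. B \<subseteq> A}. ennreal (\<rho> B))"

primrec line_integral :: "line_measure \<Rightarrow> (real \<Rightarrow> complex) \<Rightarrow> complex" where
  "line_integral (Complex_Measure \<mu>) f =
     ((LINT y|jordan_pos (\<lambda>A. Re (\<mu> A)). f y) - (LINT y|jordan_pos (\<lambda>A. - Re (\<mu> A)). f y))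
     + \<i> * ((LINT y|jordan_pos (\<lambda>A. Im (\<mu> A)). f y) - (LINT y|jordan_pos (\<lambda>A. - Im (\<mu> A)). f y))"
| "line_integral (Positive_Measure M) f = (LINT y|M. f y)"

(* For t < 1 the values growth_norm t and growth_norm 1 are equivalent only up to a factor of
   order 1/t, so bounds that are to be uniform as t tends to 0 use growth_norm (max 1 t). *)
definition growth_norm :: "real \<Rightarrow> line_measure \<Rightarrow> ennreal" where
  "growth_norm t \<nu> =
     (SUP (x, r)\<in>UNIV \<times> {0<..}. emeasure (variation \<nu>) {x - r..x + r} / ennreal (r + 1 / t))"

definition growth_class :: "real \<Rightarrow> line_measure set" where
  "growth_class t = {\<nu>. is_line_measure \<nu> \<and> growth_norm t \<nu> < \<infinity>}"

definition MZ :: "real \<Rightarrow> line_measure set" where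
  "MZ n = {\<nu> \<in> growth_class n.
             \<forall>P\<in>hermite_space n. \<forall>Q\<in>hermite_space n.
               (LINT y|lborel. P y * Q y) = line_integral \<nu> (\<lambda>y. P y * Q y)}"


definition low_pass_filter :: "(real \<Rightarrow> real) \<Rightarrow> bool" where
  "low_pass_filter h \<longleftrightarrow>
     range h \<subseteq> {0..1} \<and>
     (\<forall>u. h (- u) = h u) \<and>
     (\<forall>k u. (deriv ^^ k) h field_differentiable at u) \<and>
     (\<forall>u. \<bar>u\<bar> \<le> 1/2 \<longrightarrow> h u = 1) \<and>
     antimono_on {1/2..1} h \<and>
     (\<forall>u. \<bar>u\<bar> \<ge> 1 \<longrightarrow> h u = 0)"

definition kernel :: "(real \<Rightarrow> real) \<Rightarrow> real \<Rightarrow> real \<Rightarrow> real \<Rightarrow> real" where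
  "kernel h n x y = (\<Sum>j. h (sqrt (real j) / n) * hermite_fn j x * hermite_fn j y)"

definition sigma_op ::
    "(real \<Rightarrow> real) \<Rightarrow> real \<Rightarrow> line_measure \<Rightarrow> (real \<Rightarrow> complex) \<Rightarrow> real \<Rightarrow> complex" where
  "sigma_op h n \<nu> f x = line_integral \<nu> (\<lambda>y. complex_of_real (kernel h n x y) * f y)"

(* The functions for which sigma_op is an honest integral: L^1(nu) + L^infinity, with
   boundedness read almost everywhere with respect to |nu|, since a Lebesgue-null set need not
   be |nu|-null. *)
definition sigma_domain :: "line_measure \<Rightarrow> (real \<Rightarrow> complex) set" where
  "sigma_domain \<nu> =
     {f. \<exists>g\<in>Lp_space (variation \<nu>) 1. \<exists>b\<in>Lp_space (variation \<nu>) \<infinity>. f = (\<lambda>x. g x + b x)}"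

(* For an arbitrary MZ measure sigma_op is not bounded with respect to the Lebesgue norm: for
   nu = sqrt pi times the point mass at 0, which lies in MZ 1, it is sensitive to the single
   value f 0, which no Lebesgue norm controls.  The bound needed is that the norm in L^p(|nu|)
   of the errors f - Q is controlled by the Lebesgue norm.  The lemmas norm_controlled_lborel and
   norm_controlled_continuous cover the
   standard situations: Lebesgue measure (any p and f) and uniform approximation of
   continuous functions (any nu). *)
definition norm_controlled ::
    "real \<Rightarrow> real \<Rightarrow> line_measure \<Rightarrow> ennreal \<Rightarrow> (real \<Rightarrow> complex) \<Rightarrow> bool" where
  "norm_controlled K t \<nu> p f \<longleftrightarrow>
     (\<forall>Q\<in>hermite_space t.
        Lp_norm (variation \<nu>) p (\<lambda>x. f x - Q x) \<le> ennreal K * Lp_norm lborel p (\<lambda>x. f x - Q x))"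

lemma norm_controlled_lborel: "norm_controlled 1 t (Positive_Measure lborel) p f"
  by (simp add: norm_controlled_def)

lemma deriv_exp_sq_form:
  "\<exists>p :: real poly. (deriv ^^ j) (\<lambda>u::real. exp (- u\<^sup>2)) = (\<lambda>u. poly p u * exp (- u\<^sup>2))"
proof (induction j)
  case 0
  show ?case by (rule exI[of _ 1]) simp
next
  case (Suc j)
  then obtain p :: "real poly"
    where p: "(deriv ^^ j) (\<lambda>u::real. exp (- u\<^sup>2)) = (\<lambda>u. poly p u * exp (- u\<^sup>2))" by blast
  have "((\<lambda>u. poly p u * exp (- u\<^sup>2)) has_field_derivative
           poly (pderiv p - [:0, 2:] * p) x * exp (- x\<^sup>2)) (at x)" for x :: real
    by (rule derivative_eq_intros refl | simp add: algebra_simps)+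
  then have "deriv (\<lambda>u. poly p u * exp (- u\<^sup>2))
               = (\<lambda>x. poly (pderiv p - [:0, 2:] * p) x * exp (- x\<^sup>2))"
    by (intro ext DERIV_imp_deriv)
  then have "(deriv ^^ Suc j) (\<lambda>u::real. exp (- u\<^sup>2))
               = (\<lambda>x. poly (pderiv p - [:0, 2:] * p) x * exp (- x\<^sup>2))"
    by (simp add: p)
  then show ?case by blast
qed

lemma continuous_hermite_fn: "continuous_on UNIV (hermite_fn j)"
proof -
  obtain p :: "real poly"
    where p: "(deriv ^^ j) (\<lambda>u::real. exp (- u\<^sup>2)) = (\<lambda>u. poly p u * exp (- u\<^sup>2))"
    using deriv_exp_sq_form by blast
  show ?thesis
    unfolding hermite_fn_def[abs_def] p by (auto intro!: continuous_intros)
qed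

lemma norm_controlled_continuous:
  assumes "is_line_measure \<nu>" "continuous_on UNIV f"
  shows "norm_controlled 1 t \<nu> \<infinity> f"
  unfolding norm_controlled_def
proof
  fix Q assume "Q \<in> hermite_space t"
  then have "continuous_on UNIV Q"
    unfolding hermite_space_def
    by (auto intro!: continuous_intros continuous_on_compose2[OF continuous_hermite_fn])
  define g where "g = (\<lambda>x. ennreal (cmod (f x - Q x)))"
  have g: "continuous_on UNIV g"
    unfolding g_def using assms(2) \<open>continuous_on UNIV Q\<close>
    by (intro continuous_on_ennreal continuous_intros)
  have sets: "sets (variation \<nu>) = sets borel"
    using assms(1) by (cases \<nu>) (auto simp: sets.sigma_sets_eq[of borel, simplified])
  have le: "g x \<le> esssup lborel g" for x
  proof (rule ccontr)
    assume x: "\<not> g x \<le> esssup lborel g"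
    define U where "U = g -` {esssup lborel g<..}"
    have U: "open U" unfolding U_def using g by (simp add: continuous_on_open_vimage)
    moreover have "x \<in> U" using x by (simp add: U_def not_le)
    moreover have "emeasure lborel U = 0"
      using esssup_zero_measure[of lborel g] by (simp add: U_def vimage_def)
    ultimately have "negligible U"
      by (simp add: negligible_iff_null_sets null_sets_completionI null_setsI)
    then show False using U \<open>x \<in> U\<close> open_not_negligible by blast
  qed
  have "g \<in> borel_measurable (variation \<nu>)"
    using borel_measurable_continuous_onI[OF g] measurable_cong_sets[OF sets refl] by blast
  then have "esssup (variation \<nu>) g \<le> esssup lborel g"
    by (rule esssup_I) (use le in simp)
  then show "Lp_norm (variation \<nu>) \<infinity> (\<lambda>x. f x - Q x)
               \<le> ennreal 1 * Lp_norm lborel \<infinity> (\<lambda>x. f x - Q x)"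
    by (simp add: Lp_norm_def g_def)
qed

end

(*
The operator reproduces the Hermite space of order n/2, so the error of sigma_n f equals
(sigma_n - I)(f - Q) for every Q in that space; everything reduces to a uniform bound of
sigma_n from L^p(|nu|) to L^p.  This follows from Schur's test and the localization
|Phi_n(x,y)| <= c N / (1 + N|x-y|)^2 with N = max 1 n.  The localization is elementary:
by the three-term recurrence, multiplying Phi_n by (x-y)^2 replaces the coefficients
h(sqrt j / n) by their first and second differences, of sizes n^-2 and n^-4 since
s |-> h(sqrt s) is smooth, and what remains is controlled by the sum of psi_j^2 over j < m.
That sum is at most sqrt(2m), because its derivative is -sqrt(2m) psi_{m-1} psi_m,
and orthonormality bounds the integral of |psi_{m-1} psi_m| by 1.
*)

theory Submission
  imports Defs "HOL-Probability.Distributions"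
begin

section \<open>Localization weights\<close>

text \<open>Two powers of \<open>x - y\<close> are both affordable and sufficient. Each
  multiplication costs a factor \<open>jac\<close> of order sqrt j <= n and gains a difference of
  order n^-2. After two of them, coefficients of order n^-2 meet diagonal sums of order n, so (x -
  y)^2 Phi_n = O(1/n), while Phi_n = O(n) outright. One power would leave decay like 1/|x - y|,
  which is not integrable. Quadratic decay makes the kernel integrable uniformly in n, against
  Lebesgue measure and against every measure whose interval masses are controlled at scale N, which
  is the input of Schur's test. For n < 1 only psi_0 survives and the kernel no longer depends on n,
  hence the scale max 1 n. A complex measure acts through four Jordan parts. Each is dominated
  setwise by the total variation, so all estimates are made for one positive measure, at the price
  of a factor 4. This loss, like the factor \<open>2 powr r\<close> in the triangle inequality and
  the \<open>A + 1\<close> in the Jensen-type bound, is harmless: c only has to be independent of n,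
  the measure and f.\<close>

definition bump :: "real \<Rightarrow> real \<Rightarrow> real" where "bump N t = N / (1 + N * \<bar>t\<bar>)\<^sup>2"

lemma bump_nonneg: "N > 0 \<Longrightarrow> bump N t \<ge> 0"
  by (simp add: bump_def)

lemma borel_measurable_bump [measurable]: "bump N \<in> borel_measurable borel"
  unfolding bump_def[abs_def] by measurable

text \<open>Let k be least with N |x - y| <= 2^k. If k > 0, minimality gives N |x - y| > 2^(k-1), so
  the weight is at most N / 4^(k-1) = 4 N / 4^k and the k-th term alone dominates. Step functions on
  intervals are the right majorants because the growth norm controls masses of intervals.\<close>

lemma bump_le_dyadic:
  assumes "N > 0"
  shows "ennreal (bump N (x - y)) \<le>
    (\<Sum>k. ennreal (4 * N / 4 ^ k) * indicator {x - 2 ^ k / N..x + 2 ^ k / N} y)"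
proof -
  define t where "t = \<bar>x - y\<bar>"
  have t: "t \<ge> 0" "bump N (x - y) = N / (1 + N * t)\<^sup>2" by (auto simp: t_def bump_def)
  define k where "k = (LEAST k. N * t \<le> 2 ^ k)"
  have "\<exists>k. N * t < 2 ^ k" using real_arch_pow[of 2 "N * t"] by auto
  then have ex: "\<exists>k. N * t \<le> 2 ^ k" using less_imp_le by blast
  then have k: "N * t \<le> 2 ^ k" unfolding k_def by (metis (mono_tags, lifting) LeastI)
  have b: "N / (1 + N * t)\<^sup>2 \<le> 4 * N / 4 ^ k"
  proof (cases k)
    case 0
    have "(1 + N * t)\<^sup>2 \<ge> 1" using assms t by (intro one_le_power) auto
    then have "N / (1 + N * t)\<^sup>2 \<le> N / 1" using assms by (intro divide_left_mono) auto
    then show ?thesis using 0 assms by simp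
  next
    case (Suc j)
    then have "\<not> N * t \<le> 2 ^ j" using not_less_Least[of j "\<lambda>k. N * t \<le> 2 ^ k"] by (auto simp: k_def)
    then have "(1 + N * t)\<^sup>2 \<ge> (2 ^ j)\<^sup>2" using assms t by (intro power_mono) auto
    then have "(1 + N * t)\<^sup>2 \<ge> 4 ^ j" by (simp add: power_even_eq[symmetric] power_mult)
    moreover have "(0::real) < 4 ^ j" by simp
    ultimately have "N / (1 + N * t)\<^sup>2 \<le> N / 4 ^ j"
      using assms by (intro divide_left_mono mult_pos_pos) linarith+
    then show ?thesis using Suc by simp
  qed
  have "t \<le> 2 ^ k / N" using k assms by (simp add: field_simps)
  then have y: "y \<in> {x - 2 ^ k / N..x + 2 ^ k / N}" by (auto simp: t_def abs_le_iff)
  have "ennreal (bump N (x - y)) \<le> ennreal (4 * N / 4 ^ k) * indicator {x - 2 ^ k / N..x + 2 ^ k / N} y"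
    unfolding t using b y by (auto intro!: ennreal_leI)
  also have "\<dots> = (\<Sum>j\<in>{k}. ennreal (4 * N / 4 ^ j) * indicator {x - 2 ^ j / N..x + 2 ^ j / N} y)"
    by (simp only: sum.insert[OF finite.emptyI] sum.empty empty_iff not_False_eq_True add_0_right)
  also have "\<dots> \<le> (\<Sum>j. ennreal (4 * N / 4 ^ j) * indicator {x - 2 ^ j / N..x + 2 ^ j / N} y)"
    by (rule sum_le_suminf) auto
  finally show ?thesis .
qed

text \<open>The k-th dyadic term contributes at most (4 N / 4^k) M (2^k + 1) / N <= 8 M / 2^k, and
  the geometric series sums to 16 M, uniformly in N and x.\<close>

lemma nn_integral_bump_le:
  assumes [measurable_cong]: "sets V = sets borel" and "N > 0" "M \<ge> 0"
    and V: "\<And>x r. r > 0 \<Longrightarrow> emeasure V {x - r..x + r} \<le> ennreal (M * (r + 1 / N))"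
  shows "(\<integral>\<^sup>+y. ennreal (bump N (x - y)) \<partial>V) \<le> ennreal (16 * M)"
proof -
  have "(\<integral>\<^sup>+y. ennreal (bump N (x - y)) \<partial>V) \<le>
     (\<integral>\<^sup>+y. (\<Sum>k. ennreal (4 * N / 4 ^ k) * indicator {x - 2 ^ k / N..x + 2 ^ k / N} y) \<partial>V)"
    by (intro nn_integral_mono bump_le_dyadic assms)
  also have "\<dots> = (\<Sum>k. \<integral>\<^sup>+y. ennreal (4 * N / 4 ^ k) * indicator {x - 2 ^ k / N..x + 2 ^ k / N} y \<partial>V)"
    by (intro nn_integral_suminf) measurable
  also have "\<dots> = (\<Sum>k. ennreal (4 * N / 4 ^ k) * emeasure V {x - 2 ^ k / N..x + 2 ^ k / N})"
    by (subst nn_integral_cmult_indicator) (auto simp: assms)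
  also have "\<dots> \<le> (\<Sum>k. ennreal (8 * M * (1 / 2) ^ k))"
  proof (intro suminf_le)
    fix k
    have "ennreal (4 * N / 4 ^ k) * emeasure V {x - 2 ^ k / N..x + 2 ^ k / N}
       \<le> ennreal (4 * N / 4 ^ k) * ennreal (M * (2 ^ k / N + 1 / N))"
      using assms by (intro mult_left_mono V) auto
    also have "\<dots> = ennreal (4 * M * ((2 ^ k + 1) / 4 ^ k))"
      using assms by (subst ennreal_mult[symmetric]) (auto simp: field_simps)
    also have "\<dots> \<le> ennreal (8 * M * (1 / 2) ^ k)"
    proof (intro ennreal_leI)
      have "(4::real) ^ k = 2 ^ k * 2 ^ k" by (simp add: power_mult_distrib[symmetric])
      moreover have "(1::real) \<le> 2 ^ k" by simp
      ultimately have "(2 ^ k + 1) / 4 ^ k \<le> 2 * (1 / 2 :: real) ^ k"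
        by (simp add: field_simps)
      then show "4 * M * ((2 ^ k + 1) / 4 ^ k) \<le> 8 * M * (1 / 2) ^ k"
        using assms(3) mult_left_mono[of "(2 ^ k + 1) / 4 ^ k" "2 * (1 / 2 :: real) ^ k" "4 * M"] by simp
    qed
    finally show "ennreal (4 * N / 4 ^ k) * emeasure V {x - 2 ^ k / N..x + 2 ^ k / N} \<le> ennreal (8 * M * (1 / 2) ^ k)" .
  qed auto
  also have "\<dots> = ennreal (\<Sum>k. 8 * M * (1 / 2) ^ k)"
    using assms by (intro suminf_ennreal2) (auto intro!: summable_mult summable_geometric)
  also have "(\<Sum>k. 8 * M * (1 / 2 :: real) ^ k) = 16 * M"
    by (subst suminf_mult) (auto simp: suminf_geometric intro!: summable_geometric)
  finally show ?thesis .
qed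

lemma nn_integral_bump_lborel_le:
  assumes "N > 0"
  shows "(\<integral>\<^sup>+y. ennreal (bump N (x - y)) \<partial>lborel) \<le> 32"
proof -
  \<comment> \<open>Here M = 2: the interval has length 2 r <= 2 (r + 1/N).\<close>
  have "(\<integral>\<^sup>+y. ennreal (bump N (x - y)) \<partial>lborel) \<le> ennreal (16 * 2)"
    using assms by (intro nn_integral_bump_le) (auto intro!: ennreal_leI)
  then show ?thesis by simp
qed

text \<open>Follows from (1 + |x|)^2 <= 2 (1 + x^2). It transfers the decay of Hermite functions to
  the weight \<open>bump 1\<close>, which is integrable for Lebesgue measure and for variations
  alike; \<open>0 - x\<close> is the shape of \<open>nn_integral_bump_le\<close> centred at
  0.\<close>

lemma cauchy_le_bump: "1 / (1 + x\<^sup>2) \<le> 2 * bump 1 (0 - x)"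
proof -
  have "(1 + \<bar>x\<bar>)\<^sup>2 \<le> 2 * (1 + x\<^sup>2)"
    using zero_le_power2[of "1 - \<bar>x\<bar>"] by (simp add: power2_eq_square algebra_simps)
  moreover have "1 + x\<^sup>2 > 0" "(1 + \<bar>x\<bar>)\<^sup>2 > 0"
    by (auto intro: add_pos_nonneg zero_less_power)
  ultimately have "2 / (2 * (1 + x\<^sup>2)) \<le> 2 / (1 + \<bar>x\<bar>)\<^sup>2"
    by (intro divide_left_mono mult_pos_pos) linarith+
  moreover have "2 / (2 * (1 + x\<^sup>2)) = 1 / (1 + x\<^sup>2)"
    using mult_divide_mult_cancel_left[of 2 1 "1 + x\<^sup>2"] by simp
  ultimately have "1 / (1 + x\<^sup>2) \<le> 2 / (1 + \<bar>x\<bar>)\<^sup>2" by (simp only:)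
  then show ?thesis by (simp add: bump_def)
qed

lemma integrable_cauchy_density: "integrable lborel (\<lambda>x::real. 1 / (1 + x\<^sup>2))"
proof (rule Bochner_Integration.integrable_bound)
  show "integrable lborel (\<lambda>x. 2 * bump 1 (0 - x))"
    unfolding integrable_iff_bounded
  proof safe
    have "(\<integral>\<^sup>+x. ennreal (norm (2 * bump 1 (0 - x))) \<partial>lborel)
       = (\<integral>\<^sup>+x. 2 * ennreal (bump 1 (0 - x)) \<partial>lborel)"
      using bump_nonneg[of 1] by (simp add: abs_mult ennreal_mult)
    also have "\<dots> = 2 * (\<integral>\<^sup>+x. ennreal (bump 1 (0 - x)) \<partial>lborel)"
      by (rule nn_integral_cmult) measurable
    also have "\<dots> \<le> 2 * 32" by (intro mult_left_mono nn_integral_bump_lborel_le) auto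
    also have "\<dots> < \<infinity>" by (simp add: ennreal_mult_less_top)
    finally show "(\<integral>\<^sup>+x. ennreal (norm (2 * bump 1 (0 - x))) \<partial>lborel) < \<infinity>" .
  qed measurable
  show "AE x in lborel. norm (1 / (1 + x\<^sup>2)) \<le> norm (2 * bump 1 (0 - x))"
  proof (rule AE_I2)
    fix x :: real
    have "1 + x\<^sup>2 > 0" by (auto intro: add_pos_nonneg)
    then show "norm (1 / (1 + x\<^sup>2)) \<le> norm (2 * bump 1 (0 - x))"
      using cauchy_le_bump[of x] bump_nonneg[of 1 "0 - x"] by simp
  qed
qed measurable

section \<open>Hermite functions\<close>

text \<open>The off-diagonal entry of the Jacobi matrix of multiplication by x in the Hermite basis,
  linking the indices j - 1 and j.\<close>

definition jac :: "nat \<Rightarrow> real" where "jac j = sqrt (real j / 2)"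

lemma jac_0 [simp]: "jac 0 = 0" by (simp add: jac_def)

lemma jac_pos [simp]: "jac (Suc j) > 0" by (simp add: jac_def)

lemma jac_nonneg [simp]: "jac j \<ge> 0" by (simp add: jac_def)

lemma jac_sq: "jac j * jac j = real j / 2" by (simp add: jac_def)

definition gauss_deriv :: "nat \<Rightarrow> real \<Rightarrow> real" where
  "gauss_deriv j = (deriv ^^ j) (\<lambda>u. exp (- u\<^sup>2))"

lemma gauss_deriv_0: "gauss_deriv 0 = (\<lambda>u. exp (- u\<^sup>2))"
  by (simp add: gauss_deriv_def)

lemma gauss_deriv_poly:
  obtains p :: "real poly" where "gauss_deriv j = (\<lambda>u. poly p u * exp (- u\<^sup>2))"
  using deriv_exp_sq_form unfolding gauss_deriv_def by blast

lemma gauss_deriv_DERIV: "(gauss_deriv j has_field_derivative gauss_deriv (Suc j) x) (at x)"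
proof -
  obtain p :: "real poly" where p: "gauss_deriv j = (\<lambda>u. poly p u * exp (- u\<^sup>2))"
    by (rule gauss_deriv_poly)
  have "((\<lambda>u. poly p u * exp (- u\<^sup>2)) has_field_derivative
           poly (pderiv p - [:0, 2:] * p) x * exp (- x\<^sup>2)) (at x)"
    by (rule derivative_eq_intros refl | simp add: algebra_simps)+
  then have "(gauss_deriv j has_field_derivative
           poly (pderiv p - [:0, 2:] * p) x * exp (- x\<^sup>2)) (at x)"
    by (simp only: p)
  moreover from DERIV_imp_deriv[OF this]
  have "gauss_deriv (Suc j) x = poly (pderiv p - [:0, 2:] * p) x * exp (- x\<^sup>2)"
    by (simp add: gauss_deriv_def)
  ultimately show ?thesis by simp
qed

lemma gauss_deriv_1: "gauss_deriv (Suc 0) x = - 2 * x * gauss_deriv 0 x"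
proof -
  have "(gauss_deriv 0 has_field_derivative - 2 * x * gauss_deriv 0 x) (at x)"
    unfolding gauss_deriv_0 by (rule derivative_eq_intros refl | simp)+
  then show ?thesis by (rule DERIV_unique[OF gauss_deriv_DERIV])
qed

text \<open>Repeated differentiation of g' = -2 x g for the Gaussian g: each induction step
  differentiates the previous identity and appeals to uniqueness of derivatives.\<close>

lemma gauss_deriv_rec:
  "gauss_deriv (Suc (Suc j)) x = - 2 * x * gauss_deriv (Suc j) x - 2 * real (Suc j) * gauss_deriv j x"
proof (induction j arbitrary: x)
  case 0
  have "(gauss_deriv (Suc 0) has_field_derivative
      - 2 * gauss_deriv 0 x - 2 * x * gauss_deriv (Suc 0) x) (at x)"
    unfolding gauss_deriv_1[abs_def]
    by (rule derivative_eq_intros refl gauss_deriv_DERIV)+ (simp add: gauss_deriv_1)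
  then show ?case using DERIV_unique[OF gauss_deriv_DERIV[of "Suc 0" x]] by simp
next
  case (Suc j)
  have e: "gauss_deriv (Suc (Suc j)) = (\<lambda>x. - 2 * x * gauss_deriv (Suc j) x - 2 * real (Suc j) * gauss_deriv j x)"
    by (rule ext) (rule Suc.IH)
  have "(gauss_deriv (Suc (Suc j)) has_field_derivative
      - 2 * gauss_deriv (Suc j) x - 2 * x * gauss_deriv (Suc (Suc j)) x
       - 2 * real (Suc j) * gauss_deriv (Suc j) x) (at x)"
    unfolding e by (rule derivative_eq_intros refl gauss_deriv_DERIV)+ (simp add: Suc.IH)
  from DERIV_unique[OF gauss_deriv_DERIV this] show ?case by (simp add: algebra_simps)
qed

definition hermite_const :: "nat \<Rightarrow> real" where
  "hermite_const j = (-1) ^ j / (pi powr (1/4) * 2 powr (real j / 2) * sqrt (fact j))"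

lemma hermite_fn_eq: "hermite_fn j x = hermite_const j * exp (x\<^sup>2 / 2) * gauss_deriv j x"
  by (simp add: hermite_fn_def hermite_const_def gauss_deriv_def)

lemma hermite_const_Suc: "hermite_const j = - 2 * jac (Suc j) * hermite_const (Suc j)"
proof -
  have e: "(2::real) powr (real (Suc j) / 2) = 2 powr (real j / 2) * sqrt 2"
    by (simp add: powr_half_sqrt[symmetric] powr_add[symmetric] field_simps)
  have f: "sqrt (fact (Suc j)) = sqrt (real (Suc j)) * sqrt (fact j)"
    by (simp add: real_sqrt_mult)
  have g: "2 * jac (Suc j) = sqrt 2 * sqrt (real (Suc j))"
    unfolding jac_def by (simp add: real_sqrt_divide real_div_sqrt field_simps)
  have nz: "sqrt (real (Suc j)) \<noteq> 0" "sqrt 2 \<noteq> (0::real)" "pi powr (1/4) \<noteq> 0" "sqrt (fact j) \<noteq> (0::real)"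
     "(2::real) powr (real j / 2) \<noteq> 0" by auto
  have "- 2 * jac (Suc j) * hermite_const (Suc j) = - (sqrt 2 * sqrt (real (Suc j))) * hermite_const (Suc j)"
    using g by simp
  also have "\<dots> = hermite_const j"
    unfolding hermite_const_def e f using nz by (simp add: field_simps del: of_nat_Suc)
  finally show ?thesis by simp
qed

lemma hermite_fn_DERIV_raise:
  "(hermite_fn j has_field_derivative x * hermite_fn j x - 2 * jac (Suc j) * hermite_fn (Suc j) x) (at x)"
proof -
  have "((\<lambda>x. hermite_const j * exp (x\<^sup>2 / 2) * gauss_deriv j x) has_field_derivative
      hermite_const j * (x * exp (x\<^sup>2 / 2)) * gauss_deriv j x
      + hermite_const j * exp (x\<^sup>2 / 2) * gauss_deriv (Suc j) x) (at x)"
    by (rule derivative_eq_intros refl gauss_deriv_DERIV | simp)+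
  moreover have "hermite_const j * (x * exp (x\<^sup>2 / 2)) * gauss_deriv j x
      + hermite_const j * exp (x\<^sup>2 / 2) * gauss_deriv (Suc j) x =
     x * hermite_fn j x - 2 * jac (Suc j) * hermite_fn (Suc j) x"
    unfolding hermite_fn_eq by (subst (2) hermite_const_Suc) (simp add: algebra_simps)
  moreover have "hermite_fn j = (\<lambda>x. hermite_const j * exp (x\<^sup>2 / 2) * gauss_deriv j x)"
    by (rule ext) (rule hermite_fn_eq)
  ultimately show ?thesis by metis
qed

text \<open>For \<open>j = 0\<close> the truncated \<open>j - 1\<close> is harmless, since \<open>jac 0 = 0\<close>.\<close>

lemma hermite_fn_rec:
  "x * hermite_fn j x = jac (Suc j) * hermite_fn (Suc j) x + jac j * hermite_fn (j - 1) x"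
proof (cases j)
  case 0
  have "jac (Suc 0) * hermite_fn (Suc 0) x =
     (- 2 * jac (Suc 0) * hermite_const (Suc 0)) * x * exp (x\<^sup>2 / 2) * gauss_deriv 0 x"
    unfolding hermite_fn_eq gauss_deriv_1 by simp
  also have "\<dots> = x * hermite_fn 0 x"
    by (subst hermite_const_Suc[symmetric]) (simp add: hermite_fn_eq)
  finally show ?thesis using 0 by simp
next
  case (Suc i)
  \<comment> \<open>All three normalizing constants are expressed by the highest one;
    \<open>gauss_deriv_rec\<close> and \<open>jac_sq\<close> then settle the rest.\<close>
  define c where "c = hermite_const (Suc (Suc i))"
  have c1: "hermite_const (Suc i) = - 2 * jac (Suc (Suc i)) * c"
    unfolding c_def by (rule hermite_const_Suc)
  have c0: "hermite_const i = 4 * jac (Suc i) * jac (Suc (Suc i)) * c"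
    using hermite_const_Suc[of i] c1 by simp
  have "jac (Suc i) * hermite_fn i x = 4 * (jac (Suc i) * jac (Suc i)) * jac (Suc (Suc i)) * c
      * exp (x\<^sup>2 / 2) * gauss_deriv i x"
    unfolding hermite_fn_eq c0 by (simp add: algebra_simps)
  also have "\<dots> = 2 * real (Suc i) * jac (Suc (Suc i)) * c * exp (x\<^sup>2 / 2) * gauss_deriv i x"
    unfolding jac_sq by simp
  finally have 1: "jac (Suc i) * hermite_fn i x = \<dots>" .
  have "jac (Suc (Suc i)) * hermite_fn (Suc (Suc i)) x =
     jac (Suc (Suc i)) * c * exp (x\<^sup>2 / 2) *
      (- 2 * x * gauss_deriv (Suc i) x - 2 * real (Suc i) * gauss_deriv i x)"
    unfolding hermite_fn_eq c_def gauss_deriv_rec by simp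
  with 1 have "jac (Suc (Suc i)) * hermite_fn (Suc (Suc i)) x + jac (Suc i) * hermite_fn i x =
     jac (Suc (Suc i)) * c * exp (x\<^sup>2 / 2) * (- 2 * x * gauss_deriv (Suc i) x)"
    by (simp only: algebra_simps)
  also have "\<dots> = x * hermite_fn (Suc i) x"
    unfolding hermite_fn_eq c1 by simp
  finally show ?thesis using Suc by simp
qed

lemma hermite_fn_DERIV_lower:
  "(hermite_fn j has_field_derivative 2 * jac j * hermite_fn (j - 1) x - x * hermite_fn j x) (at x)"
proof -
  have "2 * jac j * hermite_fn (j - 1) x - x * hermite_fn j x =
     x * hermite_fn j x - 2 * jac (Suc j) * hermite_fn (Suc j) x"
    using hermite_fn_rec[of x j] by simp
  then show ?thesis using hermite_fn_DERIV_raise[of j x] by metis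
qed

text \<open>The average of the raising and the lowering relation, in which the terms with x cancel.
  This form makes the derivative of the sum of squares telescope.\<close>

lemma hermite_fn_DERIV:
  "(hermite_fn j has_field_derivative jac j * hermite_fn (j - 1) x - jac (Suc j) * hermite_fn (Suc j) x) (at x)"
proof -
  have "jac j * hermite_fn (j - 1) x - jac (Suc j) * hermite_fn (Suc j) x =
     x * hermite_fn j x - 2 * jac (Suc j) * hermite_fn (Suc j) x"
    using hermite_fn_rec[of x j] by simp
  then show ?thesis using hermite_fn_DERIV_raise[of j x] by metis
qed

text \<open>A single term of the exponential series gives |x|^i <= i! exp |x|, and |x| - x^2 / 2 <=
  1/2 because (|x| - 1)^2 >= 0.\<close>

lemma poly_times_gauss_bounded:
  fixes p :: "real poly"
  obtains C where "C > 0" "\<And>x. \<bar>poly p x * exp (- x\<^sup>2 / 2)\<bar> \<le> C"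
proof -
  define B where "B = (\<Sum>i\<le>degree p. \<bar>coeff p i\<bar> * fact i)"
  have "B \<ge> 0" unfolding B_def by (rule sum_nonneg) simp
  have pow: "\<bar>x\<bar> ^ i \<le> fact i * exp \<bar>x\<bar>" for x :: real and i
  proof -
    have "(\<Sum>k\<in>{i}. \<bar>x\<bar> ^ k /\<^sub>R fact k) \<le> (\<Sum>k. \<bar>x\<bar> ^ k /\<^sub>R fact k)"
      by (rule sum_le_suminf) (simp_all only: summable_exp_generic, simp_all)
    then show ?thesis by (simp add: exp_def field_simps)
  qed
  have p: "\<bar>poly p x\<bar> \<le> B * exp \<bar>x\<bar>" for x
  proof -
    have "\<bar>poly p x\<bar> \<le> (\<Sum>i\<le>degree p. \<bar>coeff p i\<bar> * \<bar>x\<bar> ^ i)"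
      unfolding poly_altdef by (rule order_trans[OF sum_abs]) (simp add: abs_mult power_abs)
    also have "\<dots> \<le> (\<Sum>i\<le>degree p. \<bar>coeff p i\<bar> * (fact i * exp \<bar>x\<bar>))"
      by (intro sum_mono mult_left_mono pow) auto
    also have "\<dots> = B * exp \<bar>x\<bar>" by (simp add: B_def sum_distrib_right mult.assoc)
    finally show ?thesis .
  qed
  have e: "exp \<bar>x\<bar> * exp (- x\<^sup>2 / 2) \<le> exp (1/2)" for x :: real
  proof -
    have "0 \<le> (\<bar>x\<bar> - 1)\<^sup>2" by simp
    also have "\<dots> = x\<^sup>2 - 2 * \<bar>x\<bar> + 1" by (simp add: power2_diff)
    finally have "\<bar>x\<bar> + (- x\<^sup>2 / 2) \<le> 1/2" by linarith
    then show ?thesis unfolding exp_add[symmetric] by (rule exp_le_cancel_iff[THEN iffD2])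
  qed
  \<comment> \<open>The added 1 keeps the bound strictly positive even when p = 0.\<close>
  have "\<bar>poly p x * exp (- x\<^sup>2 / 2)\<bar> \<le> B * exp (1/2) + 1" for x
  proof -
    have "\<bar>poly p x * exp (- x\<^sup>2 / 2)\<bar> = \<bar>poly p x\<bar> * exp (- x\<^sup>2 / 2)"
      by (simp only: abs_mult abs_exp_cancel)
    also have "\<dots> \<le> B * exp \<bar>x\<bar> * exp (- x\<^sup>2 / 2)"
      by (rule mult_right_mono[OF p]) simp
    also have "\<dots> \<le> B * exp (1/2)"
      unfolding mult.assoc by (rule mult_left_mono[OF e \<open>B \<ge> 0\<close>])
    finally show ?thesis by simp
  qed
  moreover have "B * exp (1/2) + 1 > 0" using \<open>B \<ge> 0\<close> by (simp add: add_nonneg_pos)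
  ultimately show ?thesis by (rule that[rotated])
qed

lemma hermite_fn_decay:
  obtains C where "C > 0" "\<And>x. \<bar>hermite_fn j x\<bar> \<le> C / (1 + x\<^sup>2)"
proof -
  obtain p :: "real poly" where p: "gauss_deriv j = (\<lambda>u. poly p u * exp (- u\<^sup>2))"
    by (rule gauss_deriv_poly)
  \<comment> \<open>The factor \<open>[:1, 0, 1:]\<close> is 1 + x^2, so a plain bound for the
    enlarged polynomial is already the claimed decay.\<close>
  obtain C where C: "C > 0" "\<And>x. \<bar>poly (smult (hermite_const j) p * [:1, 0, 1:]) x * exp (- x\<^sup>2 / 2)\<bar> \<le> C"
    using poly_times_gauss_bounded by blast
  have "\<bar>hermite_fn j x\<bar> \<le> C / (1 + x\<^sup>2)" for x
  proof -
    have e: "exp (x\<^sup>2 / 2) * exp (- x\<^sup>2) = exp (- x\<^sup>2 / 2)"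
      by (simp add: exp_add[symmetric])
    have "hermite_fn j x = hermite_const j * poly p x * (exp (x\<^sup>2 / 2) * exp (- x\<^sup>2))"
      unfolding hermite_fn_eq p by simp
    then have "hermite_fn j x * (1 + x\<^sup>2) = poly (smult (hermite_const j) p * [:1, 0, 1:]) x * exp (- x\<^sup>2 / 2)"
      unfolding e by (simp add: power2_eq_square algebra_simps)
    then have "\<bar>hermite_fn j x\<bar> * (1 + x\<^sup>2) \<le> C"
      using C(2)[of x] by (metis abs_mult abs_of_nonneg add_nonneg_nonneg zero_le_one zero_le_power2)
    then show ?thesis
      by (simp add: pos_le_divide_eq add_pos_nonneg)
  qed
  then show ?thesis using C(1) that by blast
qed

lemma borel_measurable_hermite_fn [measurable]: "hermite_fn j \<in> borel_measurable borel"
  using borel_measurable_continuous_onI[OF continuous_hermite_fn] .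

lemma hermite_fn_tendsto_0:
  "(hermite_fn j \<longlongrightarrow> 0) at_top" "(hermite_fn j \<longlongrightarrow> 0) at_bot"
proof -
  obtain C where C: "C > 0" "\<And>x. \<bar>hermite_fn j x\<bar> \<le> C / (1 + x\<^sup>2)"
    using hermite_fn_decay by blast
  have "filterlim (\<lambda>x::real. x\<^sup>2) at_top at_top" "filterlim (\<lambda>x::real. x\<^sup>2) at_top at_bot"
    by (simp_all add: filterlim_pow_at_top filterlim_pow_at_bot_even filterlim_ident)
  then have "((\<lambda>x. C / (1 + x\<^sup>2)) \<longlongrightarrow> 0) at_top" "((\<lambda>x. C / (1 + x\<^sup>2)) \<longlongrightarrow> 0) at_bot"
    by (auto intro!: tendsto_divide_0[OF tendsto_const] filterlim_at_top_imp_at_infinity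
       filterlim_tendsto_add_at_top[OF tendsto_const])
  then show "(hermite_fn j \<longlongrightarrow> 0) at_top" "(hermite_fn j \<longlongrightarrow> 0) at_bot"
    by (auto intro!: Lim_null_comparison[of _ "\<lambda>x. C / (1 + x\<^sup>2)"] always_eventually C(2))
qed

lemma integrable_hermite_fn_mult:
  "integrable lborel (\<lambda>x. hermite_fn i x * hermite_fn j x)"
proof -
  obtain C where C: "C > 0" "\<And>x. \<bar>hermite_fn i x\<bar> \<le> C / (1 + x\<^sup>2)"
    using hermite_fn_decay by blast
  obtain D where D: "D > 0" "\<And>x. \<bar>hermite_fn j x\<bar> \<le> D / (1 + x\<^sup>2)"
    using hermite_fn_decay by blast
  have D': "\<bar>hermite_fn j x\<bar> \<le> D" for x
  proof -
    have "D / (1 + x\<^sup>2) \<le> D / 1" using D(1) by (intro divide_left_mono) (auto intro: add_pos_nonneg)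
    then show ?thesis using D(2)[of x] by simp
  qed
  have "integrable lborel (\<lambda>x. C * D * (1 / (1 + x\<^sup>2)))"
    by (intro integrable_mult_right integrable_cauchy_density)
  then show ?thesis
  proof (rule Bochner_Integration.integrable_bound)
    show "AE x in lborel. norm (hermite_fn i x * hermite_fn j x) \<le> norm (C * D * (1 / (1 + x\<^sup>2)))"
    proof (intro AE_I2)
      fix x :: real
      have "\<bar>hermite_fn i x\<bar> * \<bar>hermite_fn j x\<bar> \<le> (C / (1 + x\<^sup>2)) * D"
        by (intro mult_mono C D') (use C D in \<open>auto intro!: divide_nonneg_nonneg\<close>)
      then show "norm (hermite_fn i x * hermite_fn j x) \<le> norm (C * D * (1 / (1 + x\<^sup>2)))"
        using C D by (simp add: abs_mult mult_ac)
    qed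
  qed measurable
qed

section \<open>Orthonormality of the Hermite functions\<close>

definition gram :: "nat \<Rightarrow> nat \<Rightarrow> real" where
  "gram i j = (LINT x|lborel. hermite_fn i x * hermite_fn j x)"

lemma isCont_hermite_fn: "isCont (hermite_fn j) x"
  using continuous_hermite_fn by (simp add: continuous_on_eq_continuous_at)

text \<open>Raising and lowering are adjoint. In the derivative of psi_i psi_j one factor is
  differentiated by raising and the other by lowering, so the terms with x cancel; the integral is 0
  because the product vanishes at both ends of the line.\<close>

lemma gram_ladder: "jac (Suc i) * gram (Suc i) j = jac j * gram i (j - 1)"
proof -
  let ?F = "\<lambda>x. hermite_fn i x * hermite_fn j x"
  let ?f = "\<lambda>x. 2 * jac j * (hermite_fn i x * hermite_fn (j - 1) x)
     - 2 * jac (Suc i) * (hermite_fn (Suc i) x * hermite_fn j x)"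
  have "(LBINT x=-\<infinity>..\<infinity>. ?f x) = 0 - 0"
  proof (rule interval_integral_FTC_integrable)
    show "(?F has_vector_derivative ?f x) (at x)" for x
      unfolding has_real_derivative_iff_has_vector_derivative[symmetric]
      by (rule derivative_eq_intros hermite_fn_DERIV_raise[of i] hermite_fn_DERIV_lower[of j] refl)+
         (simp add: algebra_simps)
    show "isCont ?f x" for x by (intro continuous_intros isCont_hermite_fn)
    show "set_integrable lborel (einterval (- \<infinity>) \<infinity>) ?f"
      unfolding einterval_eq_UNIV set_integrable_def
      by (simp, intro Bochner_Integration.integrable_diff integrable_mult_right integrable_hermite_fn_mult)
    show "((?F \<circ> real_of_ereal) \<longlongrightarrow> 0) (at_right (- \<infinity>))" "((?F \<circ> real_of_ereal) \<longlongrightarrow> 0) (at_left \<infinity>)"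
      unfolding comp_def at_left_PInf at_right_MInf filterlim_filtermap
      using tendsto_mult[OF hermite_fn_tendsto_0(1) hermite_fn_tendsto_0(1), of i j]
        tendsto_mult[OF hermite_fn_tendsto_0(2) hermite_fn_tendsto_0(2), of i j]
      by simp_all
  qed simp
  then have "(LINT x|lborel. ?f x) = 0"
    by (simp add: interval_lebesgue_integral_def einterval_eq_UNIV set_lebesgue_integral_def)
  also have "(LINT x|lborel. ?f x) = 2 * jac j * gram i (j - 1) - 2 * jac (Suc i) * gram (Suc i) j"
    unfolding gram_def
    by (subst Bochner_Integration.integral_diff)
       (intro integrable_mult_right integrable_hermite_fn_mult | simp)+
  finally show ?thesis by simp
qed

lemma gram_sym: "gram i j = gram j i"
  by (simp add: gram_def mult.commute)

lemma gram_0_0: "gram 0 0 = 1"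
proof -
  have e: "hermite_fn 0 x * hermite_fn 0 x = exp (- x\<^sup>2) / sqrt pi" for x
  proof -
    have p: "pi powr (1/4) * pi powr (1/4) = sqrt pi"
      by (simp add: powr_add[symmetric] powr_half_sqrt)
    have "hermite_fn 0 x = exp (- x\<^sup>2 / 2) / pi powr (1/4)"
      by (simp add: hermite_fn_def exp_add[symmetric])
    then have "hermite_fn 0 x * hermite_fn 0 x = (exp (- x\<^sup>2 / 2) * exp (- x\<^sup>2 / 2)) / (pi powr (1/4) * pi powr (1/4))"
      by simp
    then show ?thesis unfolding p exp_add[symmetric] by simp
  qed
  have "has_bochner_integral lborel (\<lambda>x. exp (- x\<^sup>2)) (2 * (sqrt pi / 2))"
    using has_bochner_integral_even_function[OF gaussian_moment_0] by simp
  then have "(LINT x|lborel. exp (- x\<^sup>2)) = sqrt pi"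
    by (simp add: has_bochner_integral_integral_eq)
  then show ?thesis unfolding gram_def e by simp
qed

text \<open>The ladder lowers both indices together. Equal indices end at \<open>gram 0 0\<close>;
  for unequal ones, one index reaches 0 first, and there \<open>jac 0 = 0\<close> annihilates the
  entry.\<close>

lemma gram_eq: "gram i j = (if i = j then 1 else 0)"
proof (induction i arbitrary: j)
  case 0
  show ?case
  proof (cases j)
    case 0
    then show ?thesis by (simp add: gram_0_0)
  next
    case (Suc k)
    have "gram (Suc k) 0 = 0" using gram_ladder[of k 0] jac_pos[of k] by simp
    then show ?thesis using Suc gram_sym by simp
  qed
next
  case (Suc i)
  have "jac (Suc i) \<noteq> 0" using jac_pos[of i] by linarith
  then show ?case
    using gram_ladder[of i j] Suc.IH[of "j - 1"] by (cases j) (auto split: if_splits)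
qed

section \<open>The diagonal of the reproducing kernel (reciprocal Christoffel function) and its
  growth\<close>

definition christoffel :: "nat \<Rightarrow> real \<Rightarrow> real" where
  "christoffel m x = (\<Sum>j<m. (hermite_fn j x)\<^sup>2)"

text \<open>By \<open>hermite_fn_DERIV\<close>, the derivative of psi_j^2 is the difference of 2 jac
  j psi_(j-1) psi_j and the same expression with j + 1 for j, so the sum telescopes to its upper
  end.\<close>

lemma christoffel_DERIV:
  "(christoffel (Suc m) has_field_derivative - 2 * jac (Suc m) * (hermite_fn m x * hermite_fn (Suc m) x)) (at x)"
proof (induction m)
  case 0
  show ?case unfolding christoffel_def
    by simp (rule derivative_eq_intros hermite_fn_DERIV[of 0] refl | simp)+
next
  case (Suc m)
  have "christoffel (Suc (Suc m)) = (\<lambda>x. christoffel (Suc m) x + (hermite_fn (Suc m) x)\<^sup>2)"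
    by (simp add: christoffel_def fun_eq_iff)
  then show ?case
    by simp (rule derivative_eq_intros Suc.IH hermite_fn_DERIV[of "Suc m"] refl | simp add: algebra_simps)+
qed

lemma christoffel_le: "christoffel (Suc m) x \<le> 2 * jac (Suc m)"
proof -
  let ?f = "\<lambda>x. - 2 * jac (Suc m) * (hermite_fn m x * hermite_fn (Suc m) x)"
  have int: "integrable lborel ?f" by (intro integrable_mult_right integrable_hermite_fn_mult)
  have "(LBINT t=-\<infinity>..ereal x. ?f t) = christoffel (Suc m) x - 0"
  proof (rule interval_integral_FTC_integrable)
    show "(christoffel (Suc m) has_vector_derivative ?f x) (at x)" for x
      unfolding has_real_derivative_iff_has_vector_derivative[symmetric] by (rule christoffel_DERIV)
    show "isCont ?f x" for x by (intro continuous_intros isCont_hermite_fn)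
    show "set_integrable lborel (einterval (- \<infinity>) (ereal x)) ?f"
      using int by (rule set_integrable_subset[of lborel UNIV, unfolded set_integrable_def, simplified, folded set_integrable_def]) auto
    have "(christoffel (Suc m) \<longlongrightarrow> (\<Sum>j<Suc m. 0\<^sup>2)) at_bot"
      unfolding christoffel_def by (intro tendsto_intros hermite_fn_tendsto_0)
    then show "((christoffel (Suc m) \<circ> real_of_ereal) \<longlongrightarrow> 0) (at_right (- \<infinity>))"
      unfolding comp_def at_right_MInf filterlim_filtermap by simp
    have "isCont (christoffel (Suc m)) x" using christoffel_DERIV by (rule DERIV_isCont)
    then show "((christoffel (Suc m) \<circ> real_of_ereal) \<longlongrightarrow> christoffel (Suc m) x) (at_left (ereal x))"
      unfolding comp_def at_left_ereal filterlim_filtermap isCont_def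
      by (simp add: filterlim_at_split)
  qed simp
  then have "christoffel (Suc m) x = (LINT t|lborel. indicator (einterval (- \<infinity>) (ereal x)) t * ?f t)"
    by (simp add: interval_lebesgue_integral_def set_lebesgue_integral_def)
  \<comment> \<open>The new integrand dominates the old one and is nonnegative, so the half-line may
    be enlarged to the whole line, where orthonormality evaluates the integral.\<close>
  also have "\<dots> \<le> (LINT t|lborel. jac (Suc m) * (hermite_fn m t * hermite_fn m t + hermite_fn (Suc m) t * hermite_fn (Suc m) t))"
  proof (rule integral_mono)
    show "integrable lborel (\<lambda>t. indicator (einterval (- \<infinity>) (ereal x)) t * ?f t)"
      using integrable_mult_indicator[OF _ int, of "einterval (- \<infinity>) (ereal x)"] by simp
    show "integrable lborel (\<lambda>t. jac (Suc m) * (hermite_fn m t * hermite_fn m t + hermite_fn (Suc m) t * hermite_fn (Suc m) t))"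
      by (intro integrable_mult_right Bochner_Integration.integrable_add integrable_hermite_fn_mult)
    fix t
    have "- 2 * (hermite_fn m t * hermite_fn (Suc m) t) \<le> hermite_fn m t * hermite_fn m t + hermite_fn (Suc m) t * hermite_fn (Suc m) t"
      using zero_le_square[of "hermite_fn m t + hermite_fn (Suc m) t"] by (simp add: algebra_simps)
    from mult_left_mono[OF this jac_nonneg[of "Suc m"]]
    have "?f t \<le> jac (Suc m) * (hermite_fn m t * hermite_fn m t + hermite_fn (Suc m) t * hermite_fn (Suc m) t)"
      by (simp add: mult_ac)
    then show "indicator (einterval (- \<infinity>) (ereal x)) t * ?f t \<le> jac (Suc m) * (hermite_fn m t * hermite_fn m t + hermite_fn (Suc m) t * hermite_fn (Suc m) t)"
      by (auto simp: indicator_def)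
  qed
  also have "\<dots> = jac (Suc m) * (gram m m + gram (Suc m) (Suc m))"
    unfolding gram_def by (simp add: integrable_hermite_fn_mult)
  also have "\<dots> = 2 * jac (Suc m)" by (simp add: gram_eq)
  finally show ?thesis .
qed

section \<open>The localized kernel\<close>

text \<open>Summation by parts for the Christoffel-Darboux type kernel: each multiplication by
  \<open>x - y\<close> replaces the coefficients by their differences.\<close>

lemma kernel_sum_once:
  fixes g :: "nat \<Rightarrow> real"
  assumes g: "\<And>j. j \<ge> m \<Longrightarrow> g j = 0"
  shows "(x - y) * (\<Sum>j<m. g j * (hermite_fn j x * hermite_fn j y)) =
    (\<Sum>j<m. (g j - g (Suc j)) * jac (Suc j) *
       (hermite_fn (Suc j) x * hermite_fn j y - hermite_fn j x * hermite_fn (Suc j) y))"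
proof -
  let ?T = "\<lambda>j. hermite_fn (Suc j) x * hermite_fn j y - hermite_fn j x * hermite_fn (Suc j) y"
  \<comment> \<open>For general k the identity carries the boundary term of the summation by parts.
    It starts at 0 by \<open>jac 0 = 0\<close> and disappears at k = m because
    \<open>g m = 0\<close>.\<close>
  have "(x - y) * (\<Sum>j<k. g j * (hermite_fn j x * hermite_fn j y)) =
     (\<Sum>j<k. (g j - g (Suc j)) * jac (Suc j) * ?T j) + g k * jac k * ?T (k - 1)" for k
  proof (induction k)
    case (Suc k)
    have "(x - y) * (hermite_fn k x * hermite_fn k y) = (x * hermite_fn k x) * hermite_fn k y - hermite_fn k x * (y * hermite_fn k y)"
      by (simp add: algebra_simps)
    also have "\<dots> = jac (Suc k) * ?T k - jac k * ?T (k - 1)"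
      unfolding hermite_fn_rec by (cases k) (simp_all add: algebra_simps)
    finally have "(x - y) * (g k * (hermite_fn k x * hermite_fn k y)) = g k * (jac (Suc k) * ?T k - jac k * ?T (k - 1))"
      by (simp only: mult.left_commute)
    then show ?case unfolding sum.lessThan_Suc distrib_left Suc
      by (simp add: algebra_simps)
  qed simp
  from this[of m] show ?thesis using g by simp
qed

text \<open>By the recurrence, \<open>x - y\<close> turns the antisymmetric product of neighbouring
  indices into symmetric products at distance two and diagonal products. Collecting them by index
  leaves differences of w weighted by \<open>jac\<close>. The diagonal sum goes up to
  \<open>Suc m\<close> because the last product, j = m - 1, reaches the diagonal index m.\<close>

lemma kernel_sum_twice:
  fixes w :: "nat \<Rightarrow> real"
  assumes w: "\<And>j. j \<ge> m \<Longrightarrow> w j = 0"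
  shows "(x - y) * (\<Sum>j<m. w j *
       (hermite_fn (Suc j) x * hermite_fn j y - hermite_fn j x * hermite_fn (Suc j) y)) =
    (\<Sum>j<m. (w j * jac (Suc (Suc j)) - w (Suc j) * jac (Suc j)) *
       (hermite_fn (Suc (Suc j)) x * hermite_fn j y + hermite_fn j x * hermite_fn (Suc (Suc j)) y))
    + 2 * (\<Sum>j<Suc m. (w j * jac (Suc j) - (if j = 0 then 0 else w (j - 1) * jac j)) * (hermite_fn j x * hermite_fn j y))"
proof -
  let ?T = "\<lambda>j. hermite_fn (Suc j) x * hermite_fn j y - hermite_fn j x * hermite_fn (Suc j) y"
  let ?S = "\<lambda>j. hermite_fn (Suc (Suc j)) x * hermite_fn j y + hermite_fn j x * hermite_fn (Suc (Suc j)) y"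
  let ?D = "\<lambda>j. hermite_fn j x * hermite_fn j y"
  let ?v = "\<lambda>j. (w j * jac (Suc j) - (if j = 0 then 0 else w (j - 1) * jac j))"
  have "(x - y) * (\<Sum>j<k. w j * ?T j) =
     (\<Sum>j<k. (w j * jac (Suc (Suc j)) - w (Suc j) * jac (Suc j)) * ?S j) + w k * jac k * ?S (k - 1)
     + 2 * (\<Sum>j<Suc k. ?v j * ?D j) - 2 * w k * jac (Suc k) * ?D k" for k
  proof (induction k)
    case (Suc k)
    have "(x - y) * ?T k = (x * hermite_fn (Suc k) x) * hermite_fn k y - (x * hermite_fn k x) * hermite_fn (Suc k) y
        - hermite_fn (Suc k) x * (y * hermite_fn k y) + hermite_fn k x * (y * hermite_fn (Suc k) y)"
      by (simp add: algebra_simps)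
    also have "\<dots> = jac (Suc (Suc k)) * ?S k - jac k * ?S (k - 1) + 2 * jac (Suc k) * (?D k - ?D (Suc k))"
      unfolding hermite_fn_rec by (cases k) (simp_all add: algebra_simps)
    finally have "(x - y) * (w k * ?T k) = w k * (jac (Suc (Suc k)) * ?S k - jac k * ?S (k - 1) + 2 * jac (Suc k) * (?D k - ?D (Suc k)))"
      by (simp only: mult.left_commute)
    then show ?case unfolding sum.lessThan_Suc[of _ k] sum.lessThan_Suc[of _ "Suc k"] distrib_left Suc
      by (simp add: algebra_simps)
  qed simp
  from this[of m] show ?thesis using w by simp
qed

text \<open>With the weights d j * jac (j + 1), both coefficients at distance two share the factor
  jac (j + 1) * jac (j + 2), which leaves a pure second difference. On the diagonal the square of
  jac j is j / 2, so (j + 1) d_j - j d_(j-1) splits into d_j and j times a second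
  difference.\<close>

lemma kernel_sum_second_difference:
  fixes g :: "nat \<Rightarrow> real"
  assumes g: "\<And>j. j \<ge> m \<Longrightarrow> g j = 0"
  defines "d \<equiv> \<lambda>j. g j - g (Suc j)"
  shows "(x - y)\<^sup>2 * (\<Sum>j<m. g j * (hermite_fn j x * hermite_fn j y)) =
    (\<Sum>j<m. (d j - d (Suc j)) * (jac (Suc j) * jac (Suc (Suc j))) *
       (hermite_fn (Suc (Suc j)) x * hermite_fn j y + hermite_fn j x * hermite_fn (Suc (Suc j)) y))
    + (\<Sum>j<Suc m. (d j + real j * (d j - d (j - 1))) * (hermite_fn j x * hermite_fn j y))"
proof -
  let ?w = "\<lambda>j. d j * jac (Suc j)"
  have 1: "?w j * jac (Suc (Suc j)) - ?w (Suc j) * jac (Suc j) = (d j - d (Suc j)) * (jac (Suc j) * jac (Suc (Suc j)))" for j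
    by (simp add: algebra_simps)
  have 2: "2 * (?w j * jac (Suc j) - (if j = 0 then 0 else ?w (j - 1) * jac j)) = d j + real j * (d j - d (j - 1))" for j
  proof -
    have "2 * (?w j * jac (Suc j) - (if j = 0 then 0 else ?w (j - 1) * jac j)) =
       2 * (d j * (jac (Suc j) * jac (Suc j)) - d (j - 1) * (jac j * jac j))"
      by (cases j) simp_all
    then show ?thesis unfolding jac_sq by (simp add: algebra_simps)
  qed
  have "(x - y)\<^sup>2 * (\<Sum>j<m. g j * (hermite_fn j x * hermite_fn j y)) =
     (x - y) * ((x - y) * (\<Sum>j<m. g j * (hermite_fn j x * hermite_fn j y)))"
    by (simp add: power2_eq_square)
  also have "\<dots> = (x - y) * (\<Sum>j<m. ?w j *
       (hermite_fn (Suc j) x * hermite_fn j y - hermite_fn j x * hermite_fn (Suc j) y))"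
    by (subst kernel_sum_once) (auto simp: g d_def)
  also have "\<dots> = (\<Sum>j<m. (?w j * jac (Suc (Suc j)) - ?w (Suc j) * jac (Suc j)) *
       (hermite_fn (Suc (Suc j)) x * hermite_fn j y + hermite_fn j x * hermite_fn (Suc (Suc j)) y))
    + 2 * (\<Sum>j<Suc m. (?w j * jac (Suc j) - (if j = 0 then 0 else ?w (j - 1) * jac j)) * (hermite_fn j x * hermite_fn j y))"
    by (rule kernel_sum_twice) (simp add: g d_def)
  finally show ?thesis unfolding 1 sum_distrib_left mult.assoc[symmetric] 2 .
qed

lemma christoffel_mono: "m \<le> k \<Longrightarrow> christoffel m x \<le> christoffel k x"
  unfolding christoffel_def by (intro sum_mono2) auto

lemma christoffel_shift: "(\<Sum>j<m. (hermite_fn (j + k) x)\<^sup>2) \<le> christoffel (m + k) x"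
proof -
  have "(\<Sum>j<m. (hermite_fn (j + k) x)\<^sup>2) = (\<Sum>j\<in>(\<lambda>j. j + k) ` {..<m}. (hermite_fn j x)\<^sup>2)"
    by (subst sum.reindex) auto
  also have "\<dots> \<le> christoffel (m + k) x"
    unfolding christoffel_def by (intro sum_mono2) auto
  finally show ?thesis .
qed

lemma hermite_fn_mult_le:
  "\<bar>hermite_fn i x * hermite_fn j y\<bar> \<le> ((hermite_fn i x)\<^sup>2 + (hermite_fn j y)\<^sup>2) / 2"
  using zero_le_power2[of "\<bar>hermite_fn i x\<bar> - \<bar>hermite_fn j y\<bar>"]
  by (simp add: power2_diff abs_mult)

text \<open>The inequality 2 a b <= a^2 + b^2 reduces a bilinear sum to two diagonal ones. The
  shifts \<open>k\<close> and \<open>l\<close> cover the diagonal and the distance-two sums in one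
  statement, with \<open>p\<close> a common bound for the indices.\<close>

lemma sum_hermite_fn_mult_le:
  fixes a :: "nat \<Rightarrow> real"
  assumes "\<And>j. j < m \<Longrightarrow> \<bar>a j\<bar> \<le> C" "C \<ge> 0" "m + k \<le> Suc p" "m + l \<le> Suc p"
  shows "\<bar>\<Sum>j<m. a j * (hermite_fn (j + k) x * hermite_fn (j + l) y)\<bar> \<le> 2 * C * jac (Suc p)"
proof -
  have "\<bar>\<Sum>j<m. a j * (hermite_fn (j + k) x * hermite_fn (j + l) y)\<bar>
     \<le> (\<Sum>j<m. C * (((hermite_fn (j + k) x)\<^sup>2 + (hermite_fn (j + l) y)\<^sup>2) / 2))"
  proof (rule order_trans[OF sum_abs], rule sum_mono)
    fix j assume "j \<in> {..<m}"
    then show "\<bar>a j * (hermite_fn (j + k) x * hermite_fn (j + l) y)\<bar>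
       \<le> C * (((hermite_fn (j + k) x)\<^sup>2 + (hermite_fn (j + l) y)\<^sup>2) / 2)"
      unfolding abs_mult[of "a j"] by (intro mult_mono hermite_fn_mult_le) (use assms in simp_all)
  qed
  also have "\<dots> = C / 2 * ((\<Sum>j<m. (hermite_fn (j + k) x)\<^sup>2) + (\<Sum>j<m. (hermite_fn (j + l) y)\<^sup>2))"
    by (simp add: sum_distrib_left sum.distrib[symmetric])
  also have "\<dots> \<le> C / 2 * (2 * jac (Suc p) + 2 * jac (Suc p))"
    using assms by (intro mult_left_mono add_mono order_trans[OF christoffel_shift]
       order_trans[OF christoffel_mono christoffel_le]) auto
  finally show ?thesis by simp
qed

text \<open>Two estimates are combined: |Phi| <= 4 n near the diagonal and (n |x - y|)^2 |Phi| <= 36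
  C n away from it. With t = n |x - y| and (1 + t)^2 <= 2 + 2 t^2 they add up to the factor 8 + 72
  C.\<close>

lemma kernel_sum_bound:
  fixes g :: "nat \<Rightarrow> real"
  assumes n: "n \<ge> 1"
    and g: "\<And>j. n\<^sup>2 \<le> real j \<Longrightarrow> g j = 0" "\<And>j. \<bar>g j\<bar> \<le> 1"
    and d: "\<And>j. \<bar>g j - g (Suc j)\<bar> \<le> C / n\<^sup>2"
    and dd: "\<And>j. \<bar>g j - 2 * g (Suc j) + g (Suc (Suc j))\<bar> \<le> C / n ^ 4"
    and m: "n\<^sup>2 \<le> real m" "real m < n\<^sup>2 + 1"
  shows "\<bar>\<Sum>j<m. g j * (hermite_fn j x * hermite_fn j y)\<bar> \<le> (8 + 72 * C) * bump n (x - y)"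
proof -
  have "C / n\<^sup>2 \<ge> 0" using d[of 0] by linarith
  then have C: "C \<ge> 0" using n by (simp add: zero_le_divide_iff)
  have n1: "n\<^sup>2 \<ge> 1" using n by (rule one_le_power)
  have gm: "g j = 0" if "j \<ge> m" for j using that m g(1)[of j] by linarith
  \<comment> \<open>The additive constants are absorbed by n >= 1: (m + 3) / 2 <= (n^2 + 4) / 2 <= 4
    n^2.\<close>
  have J: "jac (Suc p) \<le> 2 * n" if "p \<le> Suc (Suc m)" for p
  proof -
    have "real (Suc p) / 2 \<le> (2 * n)\<^sup>2"
      using that m n1 by (simp add: power_mult_distrib)
    then show ?thesis unfolding jac_def using n by (intro real_le_lsqrt) auto
  qed
  let ?Phi = "\<Sum>j<m. g j * (hermite_fn j x * hermite_fn j y)"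
  have "\<bar>?Phi\<bar> \<le> 2 * 1 * jac (Suc m)"
    using sum_hermite_fn_mult_le[of m g 1 0 m 0 x y] g(2) by simp
  with J[of m] have A: "\<bar>?Phi\<bar> \<le> 4 * n" by simp
  define d where "d = (\<lambda>j. g j - g (Suc j))"
  have d2: "\<bar>d j - d (Suc j)\<bar> \<le> C / n ^ 4" for j using dd[of j] by (simp add: d_def)
  have n4: "n ^ 4 = n\<^sup>2 * n\<^sup>2" by (simp add: power_add[symmetric])
  \<comment> \<open>A factor of order n^2 turns the size of a second difference into that of a first
    difference.\<close>
  have jj: "real k * (C / n ^ 4) \<le> c * (C / n\<^sup>2)" if "real k \<le> c * n\<^sup>2" for k c
  proof -
    have "real k * (C / n ^ 4) \<le> (c * n\<^sup>2) * (C / n ^ 4)"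
      using that C n by (intro mult_right_mono) auto
    also have "\<dots> = c * (C / n\<^sup>2)"
    proof -
      have "(c * s) * (C / (s * s)) = c * (C / s)" if "s \<noteq> 0" for s using that by simp
      from this[of "n\<^sup>2"] show ?thesis unfolding n4 using n1 by linarith
    qed
    finally show ?thesis .
  qed
  have a: "\<bar>(d j - d (Suc j)) * (jac (Suc j) * jac (Suc (Suc j)))\<bar> \<le> 3 * (C / n\<^sup>2)" if "j < m" for j
  proof -
    have "jac (Suc j) \<le> jac (Suc (Suc j))" by (simp add: jac_def)
    then have "jac (Suc j) * jac (Suc (Suc j)) \<le> jac (Suc (Suc j)) * jac (Suc (Suc j))"
      by (intro mult_right_mono) auto
    also have "\<dots> \<le> real (Suc (Suc j))" unfolding jac_sq by simp
    finally have "\<bar>(d j - d (Suc j)) * (jac (Suc j) * jac (Suc (Suc j)))\<bar> \<le> C / n ^ 4 * real (Suc (Suc j))"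
      unfolding abs_mult[of "d j - d (Suc j)"] using C by (intro mult_mono d2) auto
    also have "\<dots> \<le> 3 * (C / n\<^sup>2)"
      using jj[of "Suc (Suc j)" 3] m that n1 by (simp add: mult.commute)
    finally show ?thesis .
  qed
  \<comment> \<open>At j = 0 the truncated \<open>j - 1\<close> makes the difference 0. For j > 0 it
    is a second difference, and j <= m < n^2 + 1 <= 2 n^2; the remaining \<open>d j\<close> raises
    the 2 to 3.\<close>
  have b: "\<bar>d j + real j * (d j - d (j - 1))\<bar> \<le> 3 * (C / n\<^sup>2)" if "j < Suc m" for j
  proof -
    have "\<bar>d j - d (j - 1)\<bar> \<le> C / n ^ 4"
      using d2[of "j - 1"] C n by (cases j) auto
    then have "real j * \<bar>d j - d (j - 1)\<bar> \<le> real j * (C / n ^ 4)"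
      by (intro mult_left_mono) auto
    also have "\<dots> \<le> 2 * (C / n\<^sup>2)" using m that n1 by (intro jj) auto
    finally have "real j * \<bar>d j - d (j - 1)\<bar> \<le> 2 * (C / n\<^sup>2)" .
    moreover have "\<bar>d j\<bar> \<le> C / n\<^sup>2" using d by (simp add: d_def)
    ultimately show ?thesis
      using abs_triangle_ineq[of "d j" "real j * (d j - d (j - 1))"] by (simp add: abs_mult)
  qed
  define a' where "a' j = (d j - d (Suc j)) * (jac (Suc j) * jac (Suc (Suc j)))" for j
  define b' where "b' j = d j + real j * (d j - d (j - 1))" for j
  have Cn: "C / n\<^sup>2 * jac (Suc p) \<le> 2 * (C / n)" if "p \<le> Suc (Suc m)" for p
  proof -
    have "C / n\<^sup>2 * jac (Suc p) \<le> C / n\<^sup>2 * (2 * n)" using C by (intro mult_left_mono J that) auto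
    also have "\<dots> = 2 * (C / n)" using n by (simp add: power2_eq_square)
    finally show ?thesis .
  qed
  have "(x - y)\<^sup>2 * ?Phi =
      (\<Sum>j<m. a' j * (hermite_fn (j + 2) x * hermite_fn (j + 0) y))
    + (\<Sum>j<m. a' j * (hermite_fn (j + 0) x * hermite_fn (j + 2) y))
    + (\<Sum>j<Suc m. b' j * (hermite_fn (j + 0) x * hermite_fn (j + 0) y))"
    unfolding a'_def b'_def d_def
    by (subst kernel_sum_second_difference) (simp_all add: gm distrib_left sum.distrib del: sum.lessThan_Suc)
  moreover have "\<bar>\<Sum>j<m. a' j * (hermite_fn (j + 2) x * hermite_fn (j + 0) y)\<bar> \<le> 2 * (3 * (C / n\<^sup>2)) * jac (Suc (Suc m))"
     "\<bar>\<Sum>j<m. a' j * (hermite_fn (j + 0) x * hermite_fn (j + 2) y)\<bar> \<le> 2 * (3 * (C / n\<^sup>2)) * jac (Suc (Suc m))"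
    "\<bar>\<Sum>j<Suc m. b' j * (hermite_fn (j + 0) x * hermite_fn (j + 0) y)\<bar> \<le> 2 * (3 * (C / n\<^sup>2)) * jac (Suc (Suc m))"
    using a b C by (intro sum_hermite_fn_mult_le; auto simp: a'_def b'_def)+
  \<comment> \<open>Three sums, each at most 6 (C / n^2) jac (m + 2).\<close>
  ultimately have "\<bar>(x - y)\<^sup>2 * ?Phi\<bar> \<le> 18 * (C / n\<^sup>2 * jac (Suc (Suc m)))"
    by (simp only: abs_le_iff) (simp only: abs_le_iff mult.assoc, linarith)
  also have "\<dots> \<le> 36 * (C / n)" using Cn[of "Suc m"] by simp
  finally have "(x - y)\<^sup>2 * \<bar>?Phi\<bar> \<le> 36 * (C / n)" by (simp add: abs_mult)
  then have "n\<^sup>2 * ((x - y)\<^sup>2 * \<bar>?Phi\<bar>) \<le> n\<^sup>2 * (36 * (C / n))" by (rule mult_left_mono) simp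
  also have "\<dots> = 36 * C * n" using n by (simp add: power2_eq_square)
  finally have B: "(n * \<bar>x - y\<bar>)\<^sup>2 * \<bar>?Phi\<bar> \<le> 36 * C * n" by (simp add: power_mult_distrib mult.assoc)
  define t where "t = n * \<bar>x - y\<bar>"
  have t: "t \<ge> 0" using n by (simp add: t_def)
  have "(1 + t)\<^sup>2 \<le> 2 + 2 * t\<^sup>2" using zero_le_power2[of "1 - t"] by (simp add: power2_eq_square algebra_simps)
  then have "(1 + t)\<^sup>2 * \<bar>?Phi\<bar> \<le> (2 + 2 * t\<^sup>2) * \<bar>?Phi\<bar>" by (rule mult_right_mono) simp
  also have "\<dots> \<le> (8 + 72 * C) * n" using A B by (simp add: t_def algebra_simps)
  finally have "\<bar>?Phi\<bar> \<le> (8 + 72 * C) * n / (1 + t)\<^sup>2"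
    using t by (subst pos_le_divide_eq) (auto simp: mult.commute)
  then show ?thesis by (simp add: bump_def t_def)
qed

section \<open>Smoothness of the filter as a function of the squared frequency\<close>

lemma deriv_eq_0_of_locally_constant:
  fixes f :: "real \<Rightarrow> real"
  assumes "open S" "u \<in> S" "\<And>v. v \<in> S \<Longrightarrow> f v = c"
  shows "(f has_field_derivative 0) (at u)" "deriv f u = 0"
proof -
  show *: "(f has_field_derivative 0) (at u)"
    by (rule has_field_derivative_transform_within_open[OF DERIV_const[of c] assms(1,2)]) (simp add: assms(3))
  show "deriv f u = 0" by (rule DERIV_imp_deriv[OF *])
qed

lemma bounded_of_continuous_compact_support:
  fixes f :: "real \<Rightarrow> real"
  assumes "\<And>u. isCont f u" "\<And>u. \<bar>u\<bar> > 1 \<Longrightarrow> f u = 0"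
  obtains H where "H > 0" "\<And>u. \<bar>f u\<bar> \<le> H"
proof -
  have "compact (f ` {-1..1})"
    using assms(1) by (intro compact_continuous_image continuous_at_imp_continuous_on) auto
  then obtain H where H: "H > 0" "\<And>u. u \<in> {-1..1} \<Longrightarrow> \<bar>f u\<bar> \<le> H"
    using compact_imp_bounded bounded_pos by (metis imageI real_norm_def)
  moreover have "\<bar>f u\<bar> \<le> H" for u
  proof (cases "\<bar>u\<bar> > 1")
    case False
    then have "u \<in> {-1..1}" by auto
    then show ?thesis by (rule H(2))
  qed (use assms(2)[of u] H(1) in simp)
  ultimately show ?thesis using that by blast
qed

text \<open>Since h is 1 on [-1/2, 1/2], the function s |-> h (sqrt s) is constant near 0, where
  sqrt is singular. From 1/4 on, its first two derivatives are bounded by those of h, and the mean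
  value theorem converts them into differences.\<close>

lemma filter_sqrt_differences:
  assumes h: "low_pass_filter h"
  obtains C where "C > 0"
    "\<And>s e. s \<ge> 0 \<Longrightarrow> e > 0 \<Longrightarrow> \<bar>h (sqrt s) - h (sqrt (s + e))\<bar> \<le> C * e"
    "\<And>s e. s \<ge> 0 \<Longrightarrow> e > 0 \<Longrightarrow> \<bar>h (sqrt s) - 2 * h (sqrt (s + e)) + h (sqrt (s + 2 * e))\<bar> \<le> C * e\<^sup>2"
proof -
  define h1 where "h1 = deriv h"
  define h2 where "h2 = deriv h1"
  have smooth: "(deriv ^^ k) h field_differentiable at u" for k u
    using h by (simp add: low_pass_filter_def)
  have d0: "(h has_field_derivative h1 u) (at u)" for u
    using smooth[of 0 u] by (simp add: field_differentiable_derivI h1_def)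
  have d1: "(h1 has_field_derivative h2 u) (at u)" for u
    using smooth[of 1 u] by (simp add: field_differentiable_derivI h1_def h2_def)
  have d2: "isCont h2 u" for u
    using field_differentiable_imp_continuous_at[OF smooth[of 2 u]]
    by (simp add: h1_def h2_def numeral_2_eq_2)
  have in1: "h u = 1" if "\<bar>u\<bar> \<le> 1/2" for u using h that by (simp add: low_pass_filter_def)
  have out0: "h u = 0" if "\<bar>u\<bar> \<ge> 1" for u using h that by (simp add: low_pass_filter_def)
  have op: "open {u::real. \<bar>u\<bar> < 1/2}" "open {u::real. \<bar>u\<bar> > 1}"
    by (intro open_Collect_less continuous_intros)+
  have h1_in: "h1 u = 0" if "\<bar>u\<bar> < 1/2" for u
    unfolding h1_def by (rule deriv_eq_0_of_locally_constant(2)[OF op(1), of u h 1]) (use that in1 in auto)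
  have h1_out: "h1 u = 0" if "\<bar>u\<bar> > 1" for u
    unfolding h1_def by (rule deriv_eq_0_of_locally_constant(2)[OF op(2), of u h 0]) (use that out0 in auto)
  have h2_out: "h2 u = 0" if "\<bar>u\<bar> > 1" for u
    unfolding h2_def by (rule deriv_eq_0_of_locally_constant(2)[OF op(2), of u h1 0]) (use that h1_out in auto)
  obtain H1 where H1: "H1 > 0" "\<And>u. \<bar>h1 u\<bar> \<le> H1"
    using bounded_of_continuous_compact_support[of h1] h1_out DERIV_isCont[OF d1] by blast
  obtain H2 where H2: "H2 > 0" "\<And>u. \<bar>h2 u\<bar> \<le> H2"
    using bounded_of_continuous_compact_support[of h2] h2_out d2 by blast
  define G where "G = (\<lambda>s. h (sqrt s))"
  \<comment> \<open>At 0 the quotient is the junk value 0, which is the derivative there, as \<open>h\<close> is constant near 0.\<close>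
  define G1 where "G1 = (\<lambda>s. h1 (sqrt s) / (2 * sqrt s))"
  \<comment> \<open>For s >= 1/4 this is the derivative of h' (sqrt s) / (2 sqrt s), bounded through
    1 / sqrt s <= 2 and 1 / (4 s) <= 1. For 0 <= s < 1/4, \<open>G1\<close> vanishes near s.\<close>
  define G2 where "G2 = (\<lambda>s. if s < 1/4 then 0 else (h2 (sqrt s) - h1 (sqrt s) / sqrt s) / (4 * s))"
  \<comment> \<open>\<open>sqrt\<close> is an odd function on the reals, so the region of constancy
    is a two-sided neighbourhood of 0 and a full derivative exists at 0.\<close>
  have sq: "\<bar>sqrt s\<bar> < 1/2" if "\<bar>s\<bar> < 1/4" for s
  proof -
    have "\<bar>sqrt s\<bar> = sqrt \<bar>s\<bar>" by (simp add: abs_if real_sqrt_minus)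
    also have "\<dots> < sqrt ((1/2)\<^sup>2)" using that by (intro real_sqrt_less_mono) (simp add: power2_eq_square)
    finally show ?thesis by simp
  qed
  have op4: "open {s::real. \<bar>s\<bar> < 1/4}" by (intro open_Collect_less continuous_intros)
  have G1_0: "G1 s = 0" if "\<bar>s\<bar> < 1/4" for s using sq[OF that] h1_in by (simp add: G1_def)
  have dG: "(G has_field_derivative G1 s) (at s)" if "s \<ge> 0" for s
  proof (cases "s < 1/4")
    case True
    then have "\<bar>s\<bar> < 1/4" using that by simp
    moreover have "(G has_field_derivative 0) (at s)"
      by (rule deriv_eq_0_of_locally_constant(1)[OF op4, of s G 1])
         (use \<open>\<bar>s\<bar> < 1/4\<close> sq in1 in \<open>auto simp: G_def less_imp_le\<close>)
    ultimately show ?thesis by (simp add: G1_0)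
  next
    case False
    then have "s > 0" by simp
    then have "(G has_field_derivative h1 (sqrt s) * (inverse (sqrt s) / 2)) (at s)"
      unfolding G_def by (intro DERIV_chain2[OF d0] DERIV_real_sqrt)
    moreover have "h1 (sqrt s) * (inverse (sqrt s) / 2) = G1 s"
      unfolding G1_def by (simp add: field_simps)
    ultimately show ?thesis by (simp only:)
  qed
  have dG1: "(G1 has_field_derivative G2 s) (at s)" if "s \<ge> 0" for s
  proof (cases "s < 1/4")
    case True
    then have "\<bar>s\<bar> < 1/4" using that by simp
    moreover have "(G1 has_field_derivative 0) (at s)"
      by (rule deriv_eq_0_of_locally_constant(1)[OF op4, of s G1 0])
         (use \<open>\<bar>s\<bar> < 1/4\<close> G1_0 in auto)
    ultimately show ?thesis using True by (simp add: G2_def)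
  next
    case False
    then have s: "s > 0" by simp
    define r where "r = sqrt s"
    have r: "r > 0" "s = r * r" using s by (auto simp: r_def)
    have "(G1 has_field_derivative (h2 (sqrt s) * (inverse (sqrt s) / 2) * (2 * sqrt s) -
        h1 (sqrt s) * (2 * (inverse (sqrt s) / 2))) / (2 * sqrt s * (2 * sqrt s))) (at s)"
      unfolding G1_def using s
      by (intro DERIV_divide DERIV_chain2[OF d1] DERIV_cmult DERIV_real_sqrt) auto
    moreover have "(h2 (sqrt s) * (inverse (sqrt s) / 2) * (2 * sqrt s) -
        h1 (sqrt s) * (2 * (inverse (sqrt s) / 2))) / (2 * sqrt s * (2 * sqrt s)) = G2 s"
      using False r unfolding G2_def r_def[symmetric] by (simp add: field_simps)
    ultimately show ?thesis by (simp only:)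
  qed
  have bG1: "\<bar>G1 s\<bar> \<le> H1" if "s \<ge> 0" for s
  proof (cases "s < 1/4")
    case True then show ?thesis using G1_0 that H1 by simp
  next
    case False
    then have "sqrt s \<ge> 1/2" by (intro real_le_rsqrt) (simp add: power2_eq_square)
    then have "\<bar>h1 (sqrt s)\<bar> / (2 * sqrt s) \<le> H1 / 1"
      using H1 by (intro frac_le) auto
    then show ?thesis using that by (simp add: G1_def abs_mult)
  qed
  have bG2: "\<bar>G2 s\<bar> \<le> H2 + 2 * H1" if "s \<ge> 0" for s
  proof (cases "s < 1/4")
    case True then show ?thesis using H1 H2 by (simp add: G2_def)
  next
    case False
    then have r: "sqrt s \<ge> 1/2" by (intro real_le_rsqrt) (simp add: power2_eq_square)
    have "\<bar>h1 (sqrt s)\<bar> / sqrt s \<le> H1 / (1/2)"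
      using H1 r by (intro frac_le) auto
    then have "\<bar>h1 (sqrt s)\<bar> / sqrt s \<le> 2 * H1" by simp
    moreover have "\<bar>h2 (sqrt s) - h1 (sqrt s) / sqrt s\<bar> \<le> \<bar>h2 (sqrt s)\<bar> + \<bar>h1 (sqrt s)\<bar> / sqrt s"
      using abs_triangle_ineq4[of "h2 (sqrt s)" "h1 (sqrt s) / sqrt s"] that by simp
    ultimately have "\<bar>h2 (sqrt s) - h1 (sqrt s) / sqrt s\<bar> \<le> H2 + 2 * H1" using H2(2)[of "sqrt s"] by linarith
    then have "\<bar>h2 (sqrt s) - h1 (sqrt s) / sqrt s\<bar> / (4 * s) \<le> (H2 + 2 * H1) / 1"
      using H1 H2 False by (intro frac_le) auto
    then show ?thesis using False that by (simp add: G2_def)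
  qed
  define C where "C = H2 + 2 * H1"
  have C: "C > 0" using H1 H2 by (simp add: C_def)
  show ?thesis
  proof (rule that[of C])
    fix s e :: real assume s: "s \<ge> 0" "e > 0"
    have "\<exists>z. s < z \<and> z < s + e \<and> G (s + e) - G s = (s + e - s) * G1 z"
      using s by (intro MVT2 dG) auto
    then obtain z where z: "s < z" "G (s + e) - G s = e * G1 z" by auto
    have "\<bar>G (s + e) - G s\<bar> \<le> e * C"
      unfolding z(2) abs_mult using bG1[of z] H1 H2 s z(1) by (auto simp: C_def intro!: mult_mono)
    then show "\<bar>h (sqrt s) - h (sqrt (s + e))\<bar> \<le> C * e"
      by (simp add: G_def abs_minus_commute mult.commute)
    \<comment> \<open>The second difference is the increment of \<open>?F\<close> over a step e. One
      mean value for \<open>?F\<close> and one for \<open>G1\<close> produce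
      \<open>e * (e * G2 w)\<close>.\<close>
    let ?F = "\<lambda>t. G (t + e) - G t"
    have "\<exists>z. s < z \<and> z < s + e \<and> ?F (s + e) - ?F s = (s + e - s) * (G1 (z + e) - G1 z)"
    proof (rule MVT2)
      fix x assume "s \<le> x" "x \<le> s + e"
      then show "(?F has_field_derivative G1 (x + e) - G1 x) (at x)"
        using s by (intro DERIV_diff dG) (auto simp: DERIV_shift[symmetric] dG)
    qed (use s in simp)
    then obtain z where z: "s < z" "?F (s + e) - ?F s = e * (G1 (z + e) - G1 z)" by auto
    have "\<exists>w. z < w \<and> w < z + e \<and> G1 (z + e) - G1 z = (z + e - z) * G2 w"
      using s z by (intro MVT2 dG1) auto
    then obtain w where w: "z < w" "G1 (z + e) - G1 z = e * G2 w" by auto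
    have "\<bar>?F (s + e) - ?F s\<bar> = e * (e * \<bar>G2 w\<bar>)"
      unfolding z(2) w(2) abs_mult using s by simp
    also have "\<dots> \<le> e * (e * C)" using bG2[of w] s z w by (intro mult_left_mono) (auto simp: C_def)
    finally show "\<bar>h (sqrt s) - 2 * h (sqrt (s + e)) + h (sqrt (s + 2 * e))\<bar> \<le> C * e\<^sup>2"
      by (simp add: G_def power2_eq_square algebra_simps)
  qed (rule C)
qed

section \<open>Finite kernel sums and localization of the kernel\<close>

definition freq :: "real \<Rightarrow> nat set" where "freq t = {j. sqrt (real j) < t}"

lemma finite_freq [simp]: "finite (freq t)"
proof (rule finite_subset)
  show "freq t \<subseteq> {..nat \<lceil>t\<^sup>2\<rceil>}"
  proof
    fix j assume "j \<in> freq t"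
    then have "sqrt (real j) < t" by (simp add: freq_def)
    then have "(sqrt (real j))\<^sup>2 \<le> t\<^sup>2" by (intro power_mono) auto
    then have "real j \<le> t\<^sup>2" by simp
    then show "j \<in> {..nat \<lceil>t\<^sup>2\<rceil>}" by (simp add: le_nat_iff) linarith
  qed
qed simp

lemma kernel_eq_sum:
  assumes h: "low_pass_filter h" and "n > 0" and "finite J" "freq n \<subseteq> J"
  shows "kernel h n x y = (\<Sum>j\<in>J. h (sqrt (real j) / n) * hermite_fn j x * hermite_fn j y)"
  unfolding kernel_def
proof (rule suminf_finite[OF \<open>finite J\<close>])
  fix j assume "j \<notin> J"
  then have "j \<notin> freq n" using assms by blast
  then have "n \<le> sqrt (real j)" by (simp add: freq_def)
  then have "\<bar>sqrt (real j) / n\<bar> \<ge> 1" using \<open>n > 0\<close> by simp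
  then show "h (sqrt (real j) / n) * hermite_fn j x * hermite_fn j y = 0"
    using h by (simp add: low_pass_filter_def)
qed

text \<open>For n < 1 at most the index 0 contributes, with coefficient \<open>h 0\<close> for
  either parameter. This lets the localization estimate, proved for n >= 1, serve all n > 0 at scale
  \<open>max 1 n\<close>.\<close>

lemma kernel_max_1:
  assumes h: "low_pass_filter h" and "n > 0"
  shows "kernel h n x y = kernel h (max 1 n) x y"
proof (cases "n < 1")
  case True
  have "freq 1 \<subseteq> {0}" by (auto simp: freq_def)
  moreover have "freq n \<subseteq> freq 1" using True unfolding freq_def by (blast intro: less_trans)
  ultimately have "freq n \<subseteq> {0}" "freq 1 \<subseteq> {0}" by auto
  then show ?thesis
    using kernel_eq_sum[OF h \<open>n > 0\<close>, of "{0}"] kernel_eq_sum[OF h, of 1 "{0}"] True by simp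
qed (simp add: max_def)

lemma kernel_bound:
  assumes h: "low_pass_filter h"
  obtains C where "C > 0" "\<And>n x y. n > 0 \<Longrightarrow> \<bar>kernel h n x y\<bar> \<le> C * bump (max 1 n) (x - y)"
proof -
  obtain C where C: "C > 0"
    "\<And>s e. s \<ge> 0 \<Longrightarrow> e > 0 \<Longrightarrow> \<bar>h (sqrt s) - h (sqrt (s + e))\<bar> \<le> C * e"
    "\<And>s e. s \<ge> 0 \<Longrightarrow> e > 0 \<Longrightarrow> \<bar>h (sqrt s) - 2 * h (sqrt (s + e)) + h (sqrt (s + 2 * e))\<bar> \<le> C * e\<^sup>2"
    using filter_sqrt_differences[OF h] by metis
  have *: "\<bar>kernel h n x y\<bar> \<le> (8 + 72 * C) * bump n (x - y)" if n: "n \<ge> 1" for n x y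
  proof -
    define g where "g j = h (sqrt (real j) / n)" for j
    have n0: "n > 0" using n by simp
    have gs: "g j = h (sqrt (real j / n\<^sup>2))" for j
      using n by (simp add: g_def real_sqrt_divide)
    \<comment> \<open>The least natural number that is at least n^2, hence beyond all frequencies
      below n.\<close>
    define m where "m = nat \<lceil>n\<^sup>2\<rceil>"
    have n1: "n\<^sup>2 \<ge> 1" using n by (rule one_le_power)
    have m: "n\<^sup>2 \<le> real m" "real m < n\<^sup>2 + 1" unfolding m_def using n1 by linarith+
    have sub: "freq n \<subseteq> {..<m}"
    proof
      fix j assume "j \<in> freq n"
      then have "sqrt (real j) < n" by (simp add: freq_def)
      then have "(sqrt (real j))\<^sup>2 < n\<^sup>2" by (intro power_strict_mono) auto
      then show "j \<in> {..<m}" using m by simp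
    qed
    have "kernel h n x y = (\<Sum>j<m. g j * (hermite_fn j x * hermite_fn j y))"
      using kernel_eq_sum[OF h n0 _ sub] by (simp add: g_def mult.assoc)
    moreover have "\<bar>\<dots>\<bar> \<le> (8 + 72 * C) * bump n (x - y)"
    proof (rule kernel_sum_bound[OF n _ _ _ _ m])
      fix j
      \<comment> \<open>In the variable s = j / n^2 consecutive indices are e = 1 / n^2 apart, so C
        e and C e^2 become the two required sizes.\<close>
      have e: "real (Suc j) / n\<^sup>2 = real j / n\<^sup>2 + 1 / n\<^sup>2" "real (Suc (Suc j)) / n\<^sup>2 = real j / n\<^sup>2 + 2 * (1 / n\<^sup>2)"
        by (simp_all add: add_divide_distrib)
      show "\<bar>g j\<bar> \<le> 1" using h by (auto simp: low_pass_filter_def g_def image_subset_iff)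
      show "\<bar>g j - g (Suc j)\<bar> \<le> C / n\<^sup>2"
        using C(2)[of "real j / n\<^sup>2" "1 / n\<^sup>2"] n0 unfolding gs e by simp
      show "\<bar>g j - 2 * g (Suc j) + g (Suc (Suc j))\<bar> \<le> C / n ^ 4"
        using C(3)[of "real j / n\<^sup>2" "1 / n\<^sup>2"] n0 unfolding gs e by (simp add: power_divide)
      assume "n\<^sup>2 \<le> real j"
      then have "n \<le> sqrt (real j)" using n0 by (intro real_le_rsqrt)
      then have "\<bar>sqrt (real j) / n\<bar> \<ge> 1" using n0 by simp
      then show "g j = 0" using h by (simp add: low_pass_filter_def g_def)
    qed
    ultimately show ?thesis by simp
  qed
  have "\<bar>kernel h n x y\<bar> \<le> (8 + 72 * C) * bump (max 1 n) (x - y)" if "n > 0" for n x y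
    unfolding kernel_max_1[OF h that] by (rule *) simp
  then show ?thesis using C(1) by (intro that[of "8 + 72 * C"]) auto
qed

section \<open>Variation of a complex measure\<close>

definition borel_partitions :: "real set \<Rightarrow> (nat \<Rightarrow> real set) set" where
  "borel_partitions A = {F. range F \<subseteq> sets borel \<and> disjoint_family F \<and> (\<Union>i. F i) = A}"

text \<open>The set function inside \<open>variation\<close>, named so that its countable additivity
  can be proved: only with it does \<open>measure_of\<close> return this function.\<close>

definition tvar :: "(real set \<Rightarrow> complex) \<Rightarrow> real set \<Rightarrow> ennreal" where
  "tvar \<mu> A = (SUP F\<in>borel_partitions A. \<Sum>i. ennreal (cmod (\<mu> (F i))))"

lemma borel_partitionsD:
  assumes "F \<in> borel_partitions A"
  shows "F i \<in> sets borel" "disjoint_family F" "(\<Union>i. F i) = A" "F i \<subseteq> A"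
  using assms by (auto simp: borel_partitions_def)

lemma tvar_upper: "F \<in> borel_partitions A \<Longrightarrow> (\<Sum>i. ennreal (cmod (\<mu> (F i)))) \<le> tvar \<mu> A"
  unfolding tvar_def by (rule SUP_upper)

lemma countably_additive_complex_sums:
  assumes "countably_additive_complex \<mu>" "\<And>i. F i \<in> sets borel" "disjoint_family F"
  shows "(\<lambda>i. \<mu> (F i)) sums \<mu> (\<Union>i. F i)"
  using assms by (auto simp: countably_additive_complex_def)

lemma countably_additive_complex_empty:
  assumes "countably_additive_complex \<mu>" shows "\<mu> {} = 0"
proof -
  have "(\<lambda>i::nat. \<mu> {}) sums \<mu> (\<Union>i::nat. {})"
    by (rule countably_additive_complex_sums[OF assms]) (auto simp: disjoint_family_on_def)
  then have "(\<lambda>i::nat. \<mu> {}) \<longlonglongrightarrow> 0" using sums_summable summable_LIMSEQ_zero by blast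
  then show ?thesis by (simp add: LIMSEQ_const_iff)
qed

text \<open>Puts one more disjoint piece in front of a partition; the bound by a single piece and
  monotonicity both come from this.\<close>

definition split_partition :: "real set \<Rightarrow> (nat \<Rightarrow> real set) \<Rightarrow> nat \<Rightarrow> real set" where
  "split_partition B F i = (case i of 0 \<Rightarrow> B | Suc j \<Rightarrow> F j)"

lemma split_partition_in:
  assumes "F \<in> borel_partitions A" "B \<in> sets borel" "A \<inter> B = {}"
  shows "split_partition B F \<in> borel_partitions (A \<union> B)"
proof -
  have "split_partition B F i \<in> sets borel" for i
    using borel_partitionsD(1)[OF assms(1)] assms(2) by (auto simp: split_partition_def split: nat.split)
  moreover have "disjoint_family (split_partition B F)"
    unfolding disjoint_family_on_def
  proof (intro ballI impI)
    fix i j :: nat assume ij: "i \<noteq> j"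
    have d: "F a \<inter> F b = {}" if "a \<noteq> b" for a b
      using borel_partitionsD(2)[OF assms(1)] that by (simp add: disjoint_family_on_def)
    have "F a \<inter> B = {}" "B \<inter> F a = {}" for a using borel_partitionsD(4)[OF assms(1), of a] assms(3) by blast+
    then show "split_partition B F i \<inter> split_partition B F j = {}"
      using ij by (cases i; cases j) (simp_all add: split_partition_def d)
  qed
  moreover have "(\<Union>i. split_partition B F i) = A \<union> B"
  proof -
    have "(\<Union>i. split_partition B F i) = split_partition B F 0 \<union> (\<Union>i. split_partition B F (Suc i))"
      by (subst UNIV_nat_eq) auto
    then show ?thesis using borel_partitionsD(3)[OF assms(1)] by (auto simp: split_partition_def)
  qed
  ultimately show ?thesis by (auto simp: borel_partitions_def)
qed

lemma trivial_partition_in: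
  "B \<in> sets borel \<Longrightarrow> (\<lambda>i. if i = 0 then B else {}) \<in> borel_partitions B"
  by (auto simp: borel_partitions_def disjoint_family_on_def split: if_splits)

lemma cmod_le_tvar:
  assumes "A \<in> sets borel" "B \<in> sets borel" "B \<subseteq> A"
  shows "ennreal (cmod (\<mu> B)) \<le> tvar \<mu> A"
proof -
  have "split_partition B (\<lambda>i. if i = 0 then A - B else {}) \<in> borel_partitions ((A - B) \<union> B)"
    using assms by (intro split_partition_in trivial_partition_in) auto
  moreover have "(A - B) \<union> B = A" using assms by auto
  ultimately have "(\<Sum>i. ennreal (cmod (\<mu> (split_partition B (\<lambda>i. if i = 0 then A - B else {}) i)))) \<le> tvar \<mu> A"
    using tvar_upper by metis
  moreover have "(\<Sum>i\<in>{0}. ennreal (cmod (\<mu> (split_partition B (\<lambda>i. if i = 0 then A - B else {}) i)))) \<le>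
    (\<Sum>i. ennreal (cmod (\<mu> (split_partition B (\<lambda>i. if i = 0 then A - B else {}) i))))"
    by (rule sum_le_suminf) auto
  ultimately show ?thesis by (simp add: split_partition_def)
qed

lemma tvar_mono:
  assumes "A \<in> sets borel" "B \<in> sets borel" "A \<subseteq> B"
  shows "tvar \<mu> A \<le> tvar \<mu> B"
  unfolding tvar_def[of \<mu> A]
proof (rule SUP_least)
  fix F assume F: "F \<in> borel_partitions A"
  have "split_partition (B - A) F \<in> borel_partitions (A \<union> (B - A))"
    using assms F by (intro split_partition_in) auto
  moreover have "A \<union> (B - A) = B" using assms by auto
  ultimately have *: "(\<Sum>i. ennreal (cmod (\<mu> (split_partition (B - A) F i)))) \<le> tvar \<mu> B"
    using tvar_upper by metis
  have "(\<Sum>i. ennreal (cmod (\<mu> (F i)))) = (\<Sum>i. ennreal (cmod (\<mu> (split_partition (B - A) F (Suc i)))))"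
    by (simp add: split_partition_def)
  also have "\<dots> \<le> (\<Sum>i. ennreal (cmod (\<mu> (split_partition (B - A) F i))))"
  proof (rule suminf_le_const)
    fix k
    have "(\<Sum>i<k. ennreal (cmod (\<mu> (split_partition (B - A) F (Suc i))))) \<le>
       (\<Sum>i<Suc k. ennreal (cmod (\<mu> (split_partition (B - A) F i))))"
      unfolding sum.lessThan_Suc_shift by simp
    also have "\<dots> \<le> (\<Sum>i. ennreal (cmod (\<mu> (split_partition (B - A) F i))))"
      by (rule sum_le_suminf) auto
    finally show "(\<Sum>i<k. ennreal (cmod (\<mu> (split_partition (B - A) F (Suc i))))) \<le> \<dots>" .
  qed (rule summableI)
  finally show "(\<Sum>i. ennreal (cmod (\<mu> (F i)))) \<le> tvar \<mu> B" using * by simp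
qed

text \<open>Partitions of the two sets are interleaved, at even and odd positions, into one
  partition of the union.\<close>

lemma tvar_superadditive:
  assumes "A \<in> sets borel" "B \<in> sets borel" "A \<inter> B = {}"
  shows "tvar \<mu> A + tvar \<mu> B \<le> tvar \<mu> (A \<union> B)"
proof -
  have "(\<Sum>i. ennreal (cmod (\<mu> (F i)))) + (\<Sum>i. ennreal (cmod (\<mu> (G i)))) \<le> tvar \<mu> (A \<union> B)"
    if F: "F \<in> borel_partitions A" and G: "G \<in> borel_partitions B" for F G
  proof -
    define H where "H i = (if even i then F (i div 2) else G (i div 2))" for i
    have "H i \<in> sets borel" for i
      using borel_partitionsD(1)[OF F] borel_partitionsD(1)[OF G] by (simp add: H_def)
    moreover have "disjoint_family H"
      unfolding disjoint_family_on_def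
    proof (intro ballI impI)
      fix i j :: nat assume ij: "i \<noteq> j"
      have d: "F a \<inter> F b = {}" "G a \<inter> G b = {}" if "a \<noteq> b" for a b
        using borel_partitionsD(2)[OF F] borel_partitionsD(2)[OF G] that by (simp_all add: disjoint_family_on_def)
      have "F a \<inter> G b = {}" "G b \<inter> F a = {}" for a b
        using borel_partitionsD(4)[OF F, of a] borel_partitionsD(4)[OF G, of b] assms(3) by blast+
      moreover have "i div 2 \<noteq> j div 2" if "even i = even j"
        using ij that by (metis dvd_mult_div_cancel odd_two_times_div_two_succ)
      ultimately show "H i \<inter> H j = {}"
        by (cases "even i"; cases "even j") (simp_all add: H_def d)
    qed
    moreover have "(\<Union>i. H i) = A \<union> B"
    proof
      show "(\<Union>i. H i) \<subseteq> A \<union> B"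
        using borel_partitionsD(4)[OF F] borel_partitionsD(4)[OF G] by (auto simp: H_def split: if_splits)
      have "F i = H (2 * i)" "G i = H (Suc (2 * i))" for i by (auto simp: H_def)
      then show "A \<union> B \<subseteq> (\<Union>i. H i)"
        using borel_partitionsD(3)[OF F] borel_partitionsD(3)[OF G] by blast
    qed
    ultimately have H: "H \<in> borel_partitions (A \<union> B)" by (auto simp: borel_partitions_def)
    let ?f = "\<lambda>i. ennreal (cmod (\<mu> (F i)))" and ?g = "\<lambda>i. ennreal (cmod (\<mu> (G i)))"
      and ?h = "\<lambda>i. ennreal (cmod (\<mu> (H i)))"
    have "(\<Sum>i. ?f i) + (\<Sum>i. ?g i) = (\<Sum>i. ?f i + ?g i)"
      by (rule suminf_add) (auto simp: summableI)
    also have "\<dots> \<le> (\<Sum>i. ?h i)"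
    proof (rule suminf_le_const)
      fix k
      have "(\<Sum>i<k. ?f i + ?g i) = (\<Sum>i<2 * k. ?h i)"
        by (induction k) (simp_all add: H_def add.assoc)
      also have "\<dots> \<le> (\<Sum>i. ?h i)" by (rule sum_le_suminf) auto
      finally show "(\<Sum>i<k. ?f i + ?g i) \<le> (\<Sum>i. ?h i)" .
    qed (auto simp: summableI)
    also have "\<dots> \<le> tvar \<mu> (A \<union> B)" by (rule tvar_upper[OF H])
    finally show ?thesis .
  qed
  note * = this
  have "borel_partitions A \<noteq> {}" "borel_partitions B \<noteq> {}"
    using trivial_partition_in assms by blast+
  then have "tvar \<mu> A + tvar \<mu> B = (SUP F\<in>borel_partitions A. (\<Sum>i. ennreal (cmod (\<mu> (F i)))) + tvar \<mu> B)"
    unfolding tvar_def[of \<mu> A] by (subst ennreal_SUP_add_left) auto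
  also have "\<dots> = (SUP F\<in>borel_partitions A. SUP G\<in>borel_partitions B.
      (\<Sum>i. ennreal (cmod (\<mu> (F i)))) + (\<Sum>i. ennreal (cmod (\<mu> (G i)))))"
    unfolding tvar_def[of \<mu> B] using \<open>borel_partitions B \<noteq> {}\<close> by (subst ennreal_SUP_add_right) auto
  also have "\<dots> \<le> tvar \<mu> (A \<union> B)" by (intro SUP_least) (rule *)
  finally show ?thesis .
qed

text \<open>A partition F of the union is refined to the sets F j Int A i. Countable additivity
  bounds each |\<mu> (F j)| by a sum over i, and exchanging the double sum regroups the pieces into
  partitions of the single A i.\<close>

lemma tvar_countably_subadditive:
  assumes \<mu>: "countably_additive_complex \<mu>"
    and A: "\<And>i. A i \<in> sets borel" "disjoint_family A"
  shows "tvar \<mu> (\<Union>i. A i) \<le> (\<Sum>i. tvar \<mu> (A i))"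
  unfolding tvar_def[of \<mu> "\<Union>i. A i"]
proof (rule SUP_least)
  fix F assume F: "F \<in> borel_partitions (\<Union>i. A i)"
  have "ennreal (cmod (\<mu> (F j))) \<le> (\<Sum>i. ennreal (cmod (\<mu> (F j \<inter> A i))))" for j
  proof -
    have "(\<lambda>i. \<mu> (F j \<inter> A i)) sums \<mu> (\<Union>i. F j \<inter> A i)"
      using A borel_partitionsD(1)[OF F]
      by (intro countably_additive_complex_sums[OF \<mu>]) (auto simp: disjoint_family_on_def)
    moreover have "(\<Union>i. F j \<inter> A i) = F j" using borel_partitionsD(4)[OF F, of j] by auto
    ultimately have s: "(\<lambda>i. \<mu> (F j \<inter> A i)) sums \<mu> (F j)" by simp
    then have "(\<lambda>k. ennreal (cmod (\<Sum>i<k. \<mu> (F j \<inter> A i)))) \<longlonglongrightarrow> ennreal (cmod (\<mu> (F j)))"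
      unfolding sums_def by (intro tendsto_intros) auto
    then show ?thesis
    proof (rule LIMSEQ_le_const2, intro exI allI impI)
      fix k
      have "ennreal (cmod (\<Sum>i<k. \<mu> (F j \<inter> A i))) \<le> ennreal (\<Sum>i<k. cmod (\<mu> (F j \<inter> A i)))"
        by (intro ennreal_leI norm_sum)
      also have "\<dots> = (\<Sum>i<k. ennreal (cmod (\<mu> (F j \<inter> A i))))" by (simp add: sum_ennreal)
      also have "\<dots> \<le> (\<Sum>i. ennreal (cmod (\<mu> (F j \<inter> A i))))" by (rule sum_le_suminf) auto
      finally show "ennreal (cmod (\<Sum>i<k. \<mu> (F j \<inter> A i))) \<le> (\<Sum>i. ennreal (cmod (\<mu> (F j \<inter> A i))))" .
    qed
  qed
  then have "(\<Sum>j. ennreal (cmod (\<mu> (F j)))) \<le> (\<Sum>j. \<Sum>i. ennreal (cmod (\<mu> (F j \<inter> A i))))"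
    by (intro suminf_le) auto
  also have "\<dots> = (\<Sum>i. \<Sum>j. ennreal (cmod (\<mu> (F j \<inter> A i))))"
  proof -
    \<comment> \<open>The exchange of two nonnegative series is read as an integral over counting
      measure.\<close>
    let ?f = "\<lambda>i j. ennreal (cmod (\<mu> (F j \<inter> A i)))"
    have "?f i \<in> borel_measurable (count_space UNIV)" for i by simp
    from nn_integral_suminf[of ?f, OF this] show ?thesis unfolding nn_integral_count_space_nat .
  qed
  also have "\<dots> \<le> (\<Sum>i. tvar \<mu> (A i))"
  proof (intro suminf_le)
    fix i
    have "(\<lambda>j. F j \<inter> A i) \<in> borel_partitions (A i)"
    proof -
      have "A i \<subseteq> (\<Union>j. F j)" unfolding borel_partitionsD(3)[OF F] by (rule UN_upper) simp
      then have "(\<Union>j. F j \<inter> A i) = A i" by blast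
      moreover have "F j \<inter> A i \<in> sets borel" for j using borel_partitionsD(1)[OF F] A(1) by blast
      moreover have "disjoint_family (\<lambda>j. F j \<inter> A i)"
        using borel_partitionsD(2)[OF F] unfolding disjoint_family_on_def by blast
      ultimately show ?thesis by (auto simp: borel_partitions_def)
    qed
    then show "(\<Sum>j. ennreal (cmod (\<mu> (F j \<inter> A i)))) \<le> tvar \<mu> (A i)" by (rule tvar_upper)
  qed auto
  finally show "(\<Sum>j. ennreal (cmod (\<mu> (F j)))) \<le> (\<Sum>i. tvar \<mu> (A i))" .
qed

lemma tvar_countably_superadditive:
  assumes A: "\<And>i. A i \<in> sets borel" "disjoint_family A"
  shows "(\<Sum>i. tvar \<mu> (A i)) \<le> tvar \<mu> (\<Union>i. A i)"
proof (rule suminf_le_const)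
  fix k
  have "(\<Sum>i<k. tvar \<mu> (A i)) \<le> tvar \<mu> (\<Union>i<k. A i)"
  proof (induction k)
    case (Suc k)
    have "(\<Union>i<k. A i) \<inter> A k = {}"
    proof -
      have "A i \<inter> A k = {}" if "i < k" for i using A(2) that by (simp add: disjoint_family_on_def)
      then show ?thesis by blast
    qed
    have "(\<Sum>i<Suc k. tvar \<mu> (A i)) \<le> tvar \<mu> (\<Union>i<k. A i) + tvar \<mu> (A k)"
      using Suc by (simp add: add_right_mono)
    also have "\<dots> \<le> tvar \<mu> ((\<Union>i<k. A i) \<union> A k)" using A(1) by (intro tvar_superadditive) (auto simp: \<open>(\<Union>i<k. A i) \<inter> A k = {}\<close>)
    also have "(\<Union>i<k. A i) \<union> A k = (\<Union>i<Suc k. A i)" by (auto simp: less_Suc_eq)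
    finally show ?case .
  qed simp
  also have "\<dots> \<le> tvar \<mu> (\<Union>i. A i)" using A by (intro tvar_mono) auto
  finally show "(\<Sum>i<k. tvar \<mu> (A i)) \<le> tvar \<mu> (\<Union>i. A i)" .
qed (auto simp: summableI)

lemma variation_Complex_Measure: "variation (Complex_Measure \<mu>) = measure_of UNIV (sets borel) (tvar \<mu>)"
  by (simp add: tvar_def[abs_def] borel_partitions_def)

lemma sets_variation: "is_line_measure \<nu> \<Longrightarrow> sets (variation \<nu>) = sets borel"
  by (cases \<nu>) (auto simp: sets.sigma_sets_eq[of borel, simplified])

text \<open>The two countable inequalities above make \<open>tvar\<close> a measure on the Borel
  sets, so \<open>measure_of\<close> does not fall back to the null measure.\<close>

lemma emeasure_variation_Complex_Measure:
  assumes "countably_additive_complex \<mu>" "A \<in> sets borel"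
  shows "emeasure (variation (Complex_Measure \<mu>)) A = tvar \<mu> A"
proof (rule emeasure_measure_of[OF variation_Complex_Measure])
  have "tvar \<mu> {} = 0"
  proof -
    have "(\<Sum>i. ennreal (cmod (\<mu> (F i)))) = 0" if "F \<in> borel_partitions {}" for F
      using borel_partitionsD(4)[OF that] countably_additive_complex_empty[OF assms(1)] by simp
    then have "tvar \<mu> {} \<le> 0" unfolding tvar_def by (intro SUP_least eq_refl)
    then show ?thesis by simp
  qed
  then show "positive (sets (variation (Complex_Measure \<mu>))) (tvar \<mu>)" by (simp add: positive_def)
  show "countably_additive (sets (variation (Complex_Measure \<mu>))) (tvar \<mu>)"
  proof (rule countably_additiveI)
    fix F :: "nat \<Rightarrow> real set"
    assume F: "range F \<subseteq> sets (variation (Complex_Measure \<mu>))" "disjoint_family F"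
    have "sets (variation (Complex_Measure \<mu>)) = sets borel"
      by (rule sets_variation) (simp only: is_line_measure.simps assms(1))
    then have "F i \<in> sets borel" for i using F by auto
    then show "(\<Sum>i. tvar \<mu> (F i)) = tvar \<mu> (\<Union>i. F i)"
      using tvar_countably_superadditive tvar_countably_subadditive[OF assms(1)] F(2) by (intro antisym) auto
  qed
  show "A \<in> sets (variation (Complex_Measure \<mu>))"
    using assms(2) by (subst sets_variation) (simp_all only: is_line_measure.simps assms(1))
qed simp

section \<open>Jordan parts and integration against line measures\<close>

lemma sets_jordan_pos: "sets (jordan_pos \<rho>) = sets borel"
  by (simp add: jordan_pos_def sets.sigma_sets_eq[of borel, simplified])

text \<open>No additivity of the Jordan set function is required: if it failed, \<open>measure_of\<close> would yield
  the null measure.\<close>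

lemma jordan_pos_le_variation:
  assumes "countably_additive_complex \<mu>" "\<And>A. \<rho> A \<le> cmod (\<mu> A)"
  shows "jordan_pos \<rho> \<le> variation (Complex_Measure \<mu>)"
proof -
  have s: "sets (variation (Complex_Measure \<mu>)) = sets borel"
    by (rule sets_variation) (simp only: is_line_measure.simps assms(1))
  have sp: "space (variation (Complex_Measure \<mu>)) = space (jordan_pos \<rho>)"
    by (rule sets_eq_imp_space_eq) (simp only: s sets_jordan_pos)
  have "emeasure (jordan_pos \<rho>) A \<le> emeasure (variation (Complex_Measure \<mu>)) A" for A
  proof (cases "A \<in> sets borel")
    case True
    have "(SUP B\<in>{B \<in> sets borel. B \<subseteq> A}. ennreal (\<rho> B)) \<le> tvar \<mu> A"
      using True assms(2) by (intro SUP_least) (auto intro: order_trans[OF ennreal_leI cmod_le_tvar])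
    then have "emeasure (jordan_pos \<rho>) A \<le> tvar \<mu> A"
      unfolding jordan_pos_def emeasure_measure_of_conv by auto
    then show ?thesis using emeasure_variation_Complex_Measure[OF assms(1) True] by simp
  next
    case False
    then show ?thesis using emeasure_notin_sets[of A "jordan_pos \<rho>"] sets_jordan_pos by simp
  qed
  then show ?thesis
    by (simp only: le_measure_iff sp s sets_jordan_pos le_fun_def if_True simp_thms)
qed

lemma integrable_le_measure:
  fixes f :: "'a \<Rightarrow> 'b::{banach, second_countable_topology}"
  assumes "sets M = sets N" "M \<le> N" "integrable N f"
  shows "integrable M f"
proof -
  have "f \<in> borel_measurable M"
    using assms(3) measurable_cong_sets[OF assms(1) refl] by (auto simp: integrable_iff_bounded)
  moreover have "(\<integral>\<^sup>+x. ennreal (norm (f x)) \<partial>M) \<le> (\<integral>\<^sup>+x. ennreal (norm (f x)) \<partial>N)"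
    by (rule nn_integral_mono_measure[OF assms(1,2)])
  ultimately show ?thesis using assms(3) by (auto simp: integrable_iff_bounded)
qed

lemma jordan_parts_le_variation:
  assumes "countably_additive_complex \<mu>"
  shows "jordan_pos (\<lambda>A. Re (\<mu> A)) \<le> variation (Complex_Measure \<mu>)"
    "jordan_pos (\<lambda>A. - Re (\<mu> A)) \<le> variation (Complex_Measure \<mu>)"
    "jordan_pos (\<lambda>A. Im (\<mu> A)) \<le> variation (Complex_Measure \<mu>)"
    "jordan_pos (\<lambda>A. - Im (\<mu> A)) \<le> variation (Complex_Measure \<mu>)"
  using abs_Re_le_cmod abs_Im_le_cmod
  by (auto intro!: jordan_pos_le_variation[OF assms] simp del: variation.simps simp: abs_le_iff)

lemma integrable_jordan_pos:
  assumes "countably_additive_complex \<mu>" "jordan_pos \<rho> \<le> variation (Complex_Measure \<mu>)"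
    "integrable (variation (Complex_Measure \<mu>)) (f :: real \<Rightarrow> complex)"
  shows "integrable (jordan_pos \<rho>) f"
proof (rule integrable_le_measure[OF _ assms(2,3)])
  have "sets (variation (Complex_Measure \<mu>)) = sets borel"
    by (rule sets_variation) (simp only: is_line_measure.simps assms(1))
  then show "sets (jordan_pos \<rho>) = sets (variation (Complex_Measure \<mu>))"
    by (simp only: sets_jordan_pos)
qed

text \<open>The Bochner integral is 0 on nonintegrable functions, so linearity requires
  integrability against each Jordan part separately; domination by the variation supplies it from
  one assumption.\<close>

lemma line_integral_linear:
  assumes \<nu>: "is_line_measure \<nu>" and f: "integrable (variation \<nu>) f" and g: "integrable (variation \<nu>) g"
  shows "line_integral \<nu> (\<lambda>y. a * f y + g y) = a * line_integral \<nu> f + line_integral \<nu> g"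
proof (cases \<nu>)
  case (Complex_Measure \<mu>)
  then have \<mu>: "countably_additive_complex \<mu>" using \<nu> by simp
  note int = integrable_jordan_pos[OF \<mu> jordan_parts_le_variation(1)[OF \<mu>]]
    integrable_jordan_pos[OF \<mu> jordan_parts_le_variation(2)[OF \<mu>]]
    integrable_jordan_pos[OF \<mu> jordan_parts_le_variation(3)[OF \<mu>]]
    integrable_jordan_pos[OF \<mu> jordan_parts_le_variation(4)[OF \<mu>]]
  note fg = int[OF f[unfolded Complex_Measure]] int[OF g[unfolded Complex_Measure]]
  have L: "(LINT y|M. a * f y + g y) = a * (LINT y|M. f y) + (LINT y|M. g y)"
    if "integrable M f" "integrable M g" for M
    using that by (subst Bochner_Integration.integral_add) auto
  show ?thesis unfolding Complex_Measure line_integral.simps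
    by (simp only: L fg) (simp add: algebra_simps)
next
  case (Positive_Measure M)
  then show ?thesis using f g by (simp add: Bochner_Integration.integral_add)
qed

lemma line_integral_zero: "line_integral \<nu> (\<lambda>y. 0) = 0"
  by (cases \<nu>) auto

lemma line_integral_diff:
  assumes "is_line_measure \<nu>" "integrable (variation \<nu>) f" "integrable (variation \<nu>) g"
  shows "line_integral \<nu> (\<lambda>y. f y - g y) = line_integral \<nu> f - line_integral \<nu> g"
  using line_integral_linear[OF assms(1,3,2), of "-1"] by simp

lemma line_integral_sum:
  assumes "is_line_measure \<nu>" "finite J" "\<And>j. j \<in> J \<Longrightarrow> integrable (variation \<nu>) (f j)"
  shows "line_integral \<nu> (\<lambda>y. \<Sum>j\<in>J. c j * f j y) = (\<Sum>j\<in>J. c j * line_integral \<nu> (f j))"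
  using assms(2,3)
proof (induction J)
  case (insert i J)
  have "integrable (variation \<nu>) (\<lambda>y. \<Sum>j\<in>J. c j * f j y)"
    by (intro Bochner_Integration.integrable_sum integrable_mult_right insert.prems) simp
  then show ?case
    using insert by (simp add: line_integral_linear[OF assms(1)])
qed (simp add: line_integral_zero)

text \<open>The factor 4 counts the Jordan parts of a complex measure, each of which contributes at
  most the integral against the variation.\<close>

lemma cmod_line_integral_le:
  assumes \<nu>: "is_line_measure \<nu>" and f: "integrable (variation \<nu>) f"
  shows "ennreal (cmod (line_integral \<nu> f)) \<le> 4 * (\<integral>\<^sup>+y. ennreal (cmod (f y)) \<partial>variation \<nu>)"
proof (cases \<nu>)
  case (Complex_Measure \<mu>)
  then have \<mu>: "countably_additive_complex \<mu>" using \<nu> by simp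
  let ?I = "\<integral>\<^sup>+y. ennreal (cmod (f y)) \<partial>variation \<nu>"
  have b: "ennreal (cmod (LINT y|jordan_pos \<rho>. f y)) \<le> ?I"
    if "jordan_pos \<rho> \<le> variation (Complex_Measure \<mu>)" for \<rho>
  proof -
    have "ennreal (cmod (LINT y|jordan_pos \<rho>. f y)) \<le> (\<integral>\<^sup>+y. ennreal (cmod (f y)) \<partial>jordan_pos \<rho>)"
      by (rule integral_norm_bound_ennreal, rule integrable_jordan_pos[OF \<mu> that])
        (use f Complex_Measure in \<open>simp only:\<close>)
    also have "\<dots> \<le> ?I"
      unfolding Complex_Measure
      by (rule nn_integral_mono_measure[OF _ that])
         (simp only: sets_jordan_pos sets_variation[OF \<nu>[unfolded Complex_Measure]])
    finally show ?thesis .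
  qed
  have n: "cmod ((a - b) + \<i> * (c - d)) \<le> cmod a + cmod b + cmod c + cmod d" for a b c d
  proof -
    have "cmod ((a - b) + \<i> * (c - d)) \<le> cmod (a - b) + cmod (\<i> * (c - d))" by (rule norm_triangle_ineq)
    also have "\<dots> \<le> (cmod a + cmod b) + (cmod c + cmod d)"
      unfolding norm_mult by (simp add: norm_triangle_ineq4 add_mono)
    finally show ?thesis by simp
  qed
  have e: "ennreal (w + x + y + z) = ennreal w + ennreal x + ennreal y + ennreal z"
    if "w \<ge> 0" "x \<ge> 0" "y \<ge> 0" "z \<ge> 0" for w x y z using that by simp
  have "ennreal (cmod (line_integral \<nu> f)) \<le> ?I + ?I + ?I + ?I"
    unfolding Complex_Measure line_integral.simps
    by (rule order_trans[OF ennreal_leI[OF n]], subst e, simp_all only: norm_ge_zero)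
       (intro add_mono b[unfolded Complex_Measure] jordan_parts_le_variation[OF \<mu>])
  also have "\<dots> = (1 + 1 + 1 + 1) * ?I" by (simp only: distrib_right mult_1)
  finally show ?thesis by simp
next
  case (Positive_Measure M)
  have "ennreal (cmod (line_integral \<nu> f)) \<le> 1 * (\<integral>\<^sup>+y. ennreal (cmod (f y)) \<partial>variation \<nu>)"
    using f Positive_Measure by (simp add: integral_norm_bound_ennreal)
  also have "\<dots> \<le> 4 * (\<integral>\<^sup>+y. ennreal (cmod (f y)) \<partial>variation \<nu>)" by (intro mult_right_mono) simp_all
  finally show ?thesis .
qed

section \<open>Interval masses and integrals of the weight against the variation\<close>

lemma emeasure_variation_Icc_le:
  assumes "r > 0" "t > 0"
  shows "emeasure (variation \<nu>) {x - r..x + r} \<le> growth_norm t \<nu> * ennreal (r + 1 / t)"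
proof -
  have "emeasure (variation \<nu>) {x - r..x + r} / ennreal (r + 1 / t) \<le> growth_norm t \<nu>"
    unfolding growth_norm_def using assms(1) by (auto intro!: SUP_upper2[of "(x, r)"])
  then have "emeasure (variation \<nu>) {x - r..x + r} / ennreal (r + 1 / t) * ennreal (r + 1 / t)
     \<le> growth_norm t \<nu> * ennreal (r + 1 / t)" by (rule mult_right_mono) simp
  moreover have "r + 1 / t > 0" using assms by (simp add: add_pos_pos)
  ultimately show ?thesis by (simp add: ennreal_divide_times)
qed

lemma nn_integral_bump_variation_le:
  assumes "is_line_measure \<nu>" "t > 0" "growth_norm t \<nu> \<le> ennreal M" "M \<ge> 0"
  shows "(\<integral>\<^sup>+y. ennreal (bump t (x - y)) \<partial>variation \<nu>) \<le> ennreal (16 * M)"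
proof (rule nn_integral_bump_le[OF sets_variation[OF assms(1)] assms(2,4)])
  fix x r :: real assume r: "r > 0"
  have "emeasure (variation \<nu>) {x - r..x + r} \<le> growth_norm t \<nu> * ennreal (r + 1 / t)"
    by (rule emeasure_variation_Icc_le[OF r assms(2)])
  also have "\<dots> \<le> ennreal M * ennreal (r + 1 / t)"
    by (rule mult_right_mono[OF assms(3)]) simp
  also have "\<dots> = ennreal (M * (r + 1 / t))" using assms r by (simp add: ennreal_mult)
  finally show "emeasure (variation \<nu>) {x - r..x + r} \<le> ennreal (M * (r + 1 / t))" .
qed

text \<open>Intervals around 0 have finite mass by the growth bound. Fubini's theorem in Schur's
  test relies on this.\<close>

lemma sigma_finite_variation:
  assumes "is_line_measure \<nu>" "t > 0" "growth_norm t \<nu> < \<infinity>"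
  shows "sigma_finite_measure (variation \<nu>)"
proof
  have s: "sets (variation \<nu>) = sets borel" by (rule sets_variation) fact
  have sp: "space (variation \<nu>) = UNIV" using sets_eq_imp_space_eq[OF s] by simp
  let ?A = "range (\<lambda>n::nat. {0 - real (Suc n)..0 + real (Suc n)})"
  have "emeasure (variation \<nu>) a \<noteq> \<infinity>" if a_in: "a \<in> ?A" for a
  proof -
    obtain n :: nat where a: "a = {0 - real (Suc n)..0 + real (Suc n)}" using a_in by blast
    have "emeasure (variation \<nu>) a \<le> growth_norm t \<nu> * ennreal (real (Suc n) + 1 / t)"
      unfolding a using assms(2) by (intro emeasure_variation_Icc_le) simp_all
    also have "\<dots> < \<infinity>" using assms(3) by (simp add: ennreal_mult_less_top)
    finally show ?thesis by simp
  qed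
  moreover have "\<Union>?A = UNIV"
  proof -
    have "\<exists>n. x \<in> {0 - real (Suc n)..0 + real (Suc n)}" for x
    proof -
      obtain n where "\<bar>x\<bar> \<le> real n" using real_arch_simple by blast
      then have "x \<in> {0 - real (Suc n)..0 + real (Suc n)}" by auto
      then show ?thesis by blast
    qed
    then show ?thesis by blast
  qed
  moreover have "countable ?A" "?A \<subseteq> sets (variation \<nu>)" unfolding s by auto
  ultimately show "\<exists>A. countable A \<and> A \<subseteq> sets (variation \<nu>) \<and> \<Union> A = space (variation \<nu>)
      \<and> (\<forall>a\<in>A. emeasure (variation \<nu>) a \<noteq> \<infinity>)"
    unfolding sp by blast
qed

section \<open>The operator on Hermite spaces\<close>

lemma hermite_space_iff:
  "Q \<in> hermite_space t \<longleftrightarrow> (\<exists>a. Q = (\<lambda>x. \<Sum>j\<in>freq t. a j * complex_of_real (hermite_fn j x)))"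
  by (simp add: hermite_space_def freq_def)

lemma hermite_space_mono:
  assumes "s \<le> t" shows "hermite_space s \<subseteq> hermite_space t"
proof
  fix Q assume "Q \<in> hermite_space s"
  then obtain a where Q: "Q = (\<lambda>x. \<Sum>j\<in>freq s. a j * complex_of_real (hermite_fn j x))"
    unfolding hermite_space_iff by blast
  have "freq s \<subseteq> freq t" using assms by (auto simp: freq_def)
  then have "Q = (\<lambda>x. \<Sum>j\<in>freq t. (if j \<in> freq s then a j else 0) * complex_of_real (hermite_fn j x))"
    unfolding Q by (intro ext sum.mono_neutral_cong_left) auto
  then show "Q \<in> hermite_space t" unfolding hermite_space_iff
    by (rule exI[of _ "\<lambda>j. if j \<in> freq s then a j else 0"])
qed

lemma hermite_fn_bounded: obtains C where "C > 0" "\<And>x. \<bar>hermite_fn j x\<bar> \<le> C"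
proof -
  obtain C where C: "C > 0" "\<And>x. \<bar>hermite_fn j x\<bar> \<le> C / (1 + x\<^sup>2)" using hermite_fn_decay by blast
  have "\<bar>hermite_fn j x\<bar> \<le> C" for x
  proof -
    have "C / (1 + x\<^sup>2) \<le> C / 1" using C(1) by (intro divide_left_mono) (auto intro: add_pos_nonneg)
    then show ?thesis using C(2)[of x] by simp
  qed
  then show ?thesis using C(1) that by blast
qed

lemma hermite_space_measurable:
  assumes "Q \<in> hermite_space t" shows "Q \<in> borel_measurable borel"
proof -
  obtain a where "Q = (\<lambda>x. \<Sum>j\<in>freq t. a j * complex_of_real (hermite_fn j x))"
    using assms unfolding hermite_space_iff by blast
  then show ?thesis by simp
qed

lemma hermite_space_bounded:
  assumes "Q \<in> hermite_space t" obtains B where "B > 0" "\<And>x. cmod (Q x) \<le> B"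
proof -
  obtain a where Q: "Q = (\<lambda>x. \<Sum>j\<in>freq t. a j * complex_of_real (hermite_fn j x))"
    using assms unfolding hermite_space_iff by blast
  have "\<exists>C. \<forall>x. \<bar>hermite_fn j x\<bar> \<le> C" for j by (rule hermite_fn_bounded[of j]) blast
  then have "\<exists>C. \<forall>j x. \<bar>hermite_fn j x\<bar> \<le> C j" by (intro choice) blast
  then obtain C where C: "\<And>j x. \<bar>hermite_fn j x\<bar> \<le> C j" by blast
  have "cmod (Q x) \<le> (\<Sum>j\<in>freq t. cmod (a j) * C j)" for x
    unfolding Q by (rule sum_norm_le) (auto simp: norm_mult intro!: mult_left_mono C)
  then have "cmod (Q x) \<le> max 1 (\<Sum>j\<in>freq t. cmod (a j) * C j)" for x
    by (meson max.coboundedI2)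
  then show ?thesis by (intro that[of "max 1 (\<Sum>j\<in>freq t. cmod (a j) * C j)"]) auto
qed

lemma kernel_eq_freq_sum:
  assumes "low_pass_filter h" "n > 0"
  shows "kernel h n x y = (\<Sum>j\<in>freq n. h (sqrt (real j) / n) * hermite_fn j x * hermite_fn j y)"
  by (rule kernel_eq_sum[OF assms]) auto

lemma kernel_in_hermite_space:
  assumes "low_pass_filter h" "n > 0"
  shows "(\<lambda>y. complex_of_real (kernel h n x y)) \<in> hermite_space n"
  unfolding hermite_space_iff kernel_eq_freq_sum[OF assms]
  by (rule exI[of _ "\<lambda>j. complex_of_real (h (sqrt (real j) / n) * hermite_fn j x)"]) simp

text \<open>The filter is 1 at all frequencies below n / 2, so orthonormality returns every
  coefficient of P unchanged.\<close>

lemma kernel_reproducing: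
  assumes h: "low_pass_filter h" and "n > 0" and "P \<in> hermite_space (n / 2)"
  shows "(LINT y|lborel. complex_of_real (kernel h n x y) * P y) = P x"
proof -
  obtain a where P: "P = (\<lambda>x. \<Sum>j\<in>freq (n / 2). a j * complex_of_real (hermite_fn j x))"
    using assms(3) unfolding hermite_space_iff by blast
  let ?g = "\<lambda>j. h (sqrt (real j) / n)"
  have sub: "freq (n / 2) \<subseteq> freq n" using \<open>n > 0\<close> by (auto simp: freq_def)
  have g1: "?g j = 1" if "j \<in> freq (n / 2)" for j
  proof -
    have "\<bar>sqrt (real j) / n\<bar> \<le> 1/2" using that \<open>n > 0\<close> by (simp add: freq_def field_simps)
    then show ?thesis using h by (simp add: low_pass_filter_def)
  qed
  have int: "integrable lborel (\<lambda>y. complex_of_real (hermite_fn i y * hermite_fn j y))" for i j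
    by (rule integrable_of_real[OF integrable_hermite_fn_mult])
  have I: "(LINT y|lborel. complex_of_real (hermite_fn i y * hermite_fn j y)) = (if i = j then 1 else 0)" for i j
    using gram_eq[of i j] by (simp add: gram_def del: of_real_mult)
  have "(LINT y|lborel. complex_of_real (kernel h n x y) * P y) =
     (LINT y|lborel. (\<Sum>i\<in>freq n. \<Sum>j\<in>freq (n / 2). complex_of_real (?g i * hermite_fn i x) * a j *
        complex_of_real (hermite_fn i y * hermite_fn j y)))"
    unfolding P kernel_eq_freq_sum[OF h \<open>n > 0\<close>]
    by (intro Bochner_Integration.integral_cong refl, simp only: of_real_sum sum_product) (simp add: mult_ac)
  also have "\<dots> = (\<Sum>i\<in>freq n. \<Sum>j\<in>freq (n / 2). complex_of_real (?g i * hermite_fn i x) * a j * (if i = j then 1 else 0))"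
    by (simp only: Bochner_Integration.integral_sum Bochner_Integration.integrable_sum
        integrable_mult_right int integral_mult_right_zero I)
  also have "\<dots> = (\<Sum>j\<in>freq (n / 2). \<Sum>i\<in>freq n. complex_of_real (?g i * hermite_fn i x) * a j * (if i = j then 1 else 0))"
    by (rule sum.swap)
  also have "\<dots> = (\<Sum>j\<in>freq (n / 2). complex_of_real (?g j * hermite_fn j x) * a j)"
    using sub by (intro sum.cong refl) (simp add: if_distrib sum.delta subset_iff cong: if_cong)
  also have "\<dots> = P x" unfolding P by (intro sum.cong refl) (simp add: g1 mult.commute)
  finally show ?thesis .
qed

text \<open>The kernel as a function of y and P both lie in Pi_n, so the quadrature identity in
  \<open>MZ\<close> replaces the measure by Lebesgue measure.\<close>

lemma sigma_op_reproducing: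
  assumes h: "low_pass_filter h" and "n > 0" and "\<nu> \<in> MZ n" and "P \<in> hermite_space (n / 2)"
  shows "sigma_op h n \<nu> P = P"
proof
  fix x
  have "P \<in> hermite_space n" using assms hermite_space_mono[of "n / 2" n] by auto
  then have "line_integral \<nu> (\<lambda>y. complex_of_real (kernel h n x y) * P y) =
      (LINT y|lborel. complex_of_real (kernel h n x y) * P y)"
    using assms(3) kernel_in_hermite_space[OF h \<open>n > 0\<close>] by (simp add: MZ_def)
  then show "sigma_op h n \<nu> P x = P x"
    using kernel_reproducing[OF h \<open>n > 0\<close> assms(4)] by (simp add: sigma_op_def)
qed

text \<open>The decay of psi_j makes the product with a bounded function at most a multiple of
  \<open>bump 1\<close>, which has finite integral by the growth of interval masses.\<close>

lemma integrable_hermite_fn_variation: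
  assumes \<nu>: "is_line_measure \<nu>" and "t > 0" "growth_norm t \<nu> < \<infinity>"
    and f: "f \<in> borel_measurable borel" and B: "AE y in variation \<nu>. cmod (f y) \<le> B"
  shows "integrable (variation \<nu>) (\<lambda>y. complex_of_real (hermite_fn j y) * f y)"
proof -
  have s[measurable_cong]: "sets (variation \<nu>) = sets borel" by (rule sets_variation) fact
  obtain C where C: "C > 0" "\<And>x. \<bar>hermite_fn j x\<bar> \<le> C / (1 + x\<^sup>2)" using hermite_fn_decay by blast
  define G where "G = enn2real (growth_norm t \<nu>)"
  have G: "growth_norm t \<nu> = ennreal G" "G \<ge> 0" using assms(3) by (simp_all add: G_def)
  have "(\<integral>\<^sup>+y. ennreal (bump 1 (0 - y)) \<partial>variation \<nu>) \<le> ennreal (16 * (G * (1 + 1 / t)))"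
  proof (rule nn_integral_bump_le[OF s])
    fix x r :: real assume r: "r > 0"
    have "emeasure (variation \<nu>) {x - r..x + r} \<le> ennreal G * ennreal (r + 1 / t)"
      using emeasure_variation_Icc_le[OF r \<open>t > 0\<close>, of \<nu> x] unfolding G(1) .
    also have "\<dots> = ennreal (G * (r + 1 / t))" using G(2) r \<open>t > 0\<close> by (simp add: ennreal_mult)
    \<comment> \<open>Change of scale from t to 1: r + 1/t <= (1 + 1/t) (r + 1). The constant
      depends on t, but only finiteness is wanted here.\<close>
    also have "\<dots> \<le> ennreal (G * (1 + 1 / t) * (r + 1 / 1))"
      using G(2) r \<open>t > 0\<close> unfolding mult.assoc
      by (intro ennreal_leI mult_left_mono) (simp_all add: field_simps)
    finally show "emeasure (variation \<nu>) {x - r..x + r} \<le> \<dots>" .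
  qed (use G \<open>t > 0\<close> in simp_all)
  then have bump: "integrable (variation \<nu>) (\<lambda>y. bump 1 (0 - y))"
    unfolding integrable_iff_bounded using bump_nonneg[of 1] by (auto simp: less_top[symmetric] top_unique)
  show ?thesis
  proof (rule Bochner_Integration.integrable_bound)
    show "integrable (variation \<nu>) (\<lambda>y. 2 * C * B * bump 1 (0 - y))"
      by (intro integrable_mult_right bump)
    show "(\<lambda>y. complex_of_real (hermite_fn j y) * f y) \<in> borel_measurable (variation \<nu>)"
      using f by measurable
    show "AE y in variation \<nu>. norm (complex_of_real (hermite_fn j y) * f y) \<le> norm (2 * C * B * bump 1 (0 - y))"
      using B
    proof eventually_elim
      case (elim y)
      have "\<bar>hermite_fn j y\<bar> \<le> C * (1 / (1 + y\<^sup>2))" using C(2)[of y] by simp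
      also have "\<dots> \<le> C * (2 * bump 1 (0 - y))" using C(1) by (intro mult_left_mono cauchy_le_bump) auto
      finally have "\<bar>hermite_fn j y\<bar> * cmod (f y) \<le> C * (2 * bump 1 (0 - y)) * B"
        using elim C(1) bump_nonneg[of 1 "0 - y"] by (intro mult_mono) auto
      also have "\<dots> \<le> norm (2 * C * B * bump 1 (0 - y))" by (simp add: mult_ac)
      finally show ?case by (simp add: norm_mult)
    qed
  qed
qed

text \<open>The integrable summand uses boundedness of psi_j, the bounded summand uses its
  decay.\<close>

lemma integrable_hermite_fn_sigma_domain:
  assumes \<nu>: "is_line_measure \<nu>" and t: "t > 0" "growth_norm t \<nu> < \<infinity>" and f: "f \<in> sigma_domain \<nu>"
  shows "integrable (variation \<nu>) (\<lambda>y. complex_of_real (hermite_fn j y) * f y)"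
proof -
  have s[measurable_cong]: "sets (variation \<nu>) = sets borel" by (rule sets_variation) fact
  obtain g b where gb: "g \<in> Lp_space (variation \<nu>) 1" "b \<in> Lp_space (variation \<nu>) \<infinity>" "f = (\<lambda>x. g x + b x)"
    using f unfolding sigma_domain_def by blast
  have gm[measurable]: "g \<in> borel_measurable borel" and bm[measurable]: "b \<in> borel_measurable borel"
    using gb(1,2) measurable_cong_sets[OF s refl] by (auto simp: Lp_space_def)
  have "(\<integral>\<^sup>+x. ennreal (cmod (g x)) \<partial>variation \<nu>) < \<infinity>"
    using gb(1) by (auto simp: Lp_space_def Lp_norm_def Let_def less_top split: if_splits)
  then have g: "integrable (variation \<nu>) g" by (simp add: integrable_iff_bounded)
  have "esssup (variation \<nu>) (\<lambda>x. ennreal (cmod (b x))) < \<infinity>"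
    using gb(2) by (simp add: Lp_space_def Lp_norm_def)
  then obtain B where B: "esssup (variation \<nu>) (\<lambda>x. ennreal (cmod (b x))) = ennreal B" "B \<ge> 0"
    by (cases "esssup (variation \<nu>) (\<lambda>x. ennreal (cmod (b x)))") auto
  have "AE y in variation \<nu>. ennreal (cmod (b y)) \<le> ennreal B"
    using esssup_AE[of "\<lambda>x. ennreal (cmod (b x))" "variation \<nu>"] unfolding B .
  then have bB: "AE y in variation \<nu>. cmod (b y) \<le> B" using B(2) by simp
  obtain C where C: "C > 0" "\<And>x. \<bar>hermite_fn j x\<bar> \<le> C" using hermite_fn_bounded by blast
  have "integrable (variation \<nu>) (\<lambda>y. complex_of_real (hermite_fn j y) * g y)"
  proof (rule Bochner_Integration.integrable_bound)
    show "integrable (variation \<nu>) (\<lambda>y. C * cmod (g y))" using g by simp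
    show "AE y in variation \<nu>. norm (complex_of_real (hermite_fn j y) * g y) \<le> norm (C * cmod (g y))"
      using C by (auto simp: norm_mult abs_mult intro!: mult_right_mono AE_I2)
  qed measurable
  moreover have "integrable (variation \<nu>) (\<lambda>y. complex_of_real (hermite_fn j y) * b y)"
    by (rule integrable_hermite_fn_variation[OF \<nu> t bm bB])
  ultimately show ?thesis unfolding gb(3) distrib_left by (rule Bochner_Integration.integrable_add)
qed

lemma integrable_kernel_mult:
  assumes "low_pass_filter h" "n > 0"
    "\<And>j. integrable (variation \<nu>) (\<lambda>y. complex_of_real (hermite_fn j y) * f y)"
  shows "integrable (variation \<nu>) (\<lambda>y. complex_of_real (kernel h n x y) * f y)"
proof -
  have "(\<lambda>y. complex_of_real (kernel h n x y) * f y) =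
     (\<lambda>y. \<Sum>j\<in>freq n. complex_of_real (h (sqrt (real j) / n) * hermite_fn j x) * (complex_of_real (hermite_fn j y) * f y))"
    unfolding kernel_eq_freq_sum[OF assms(1,2)] by (simp add: sum_distrib_right mult.assoc)
  then show ?thesis
    by (simp only:) (intro Bochner_Integration.integrable_sum integrable_mult_right assms(3))
qed

text \<open>The kernel is a finite sum, so the integral is taken term by term. Membership makes the
  image a competitor in the infimum, which is the left inequality of the theorem, and also gives its
  Borel measurability.\<close>

lemma sigma_op_in_hermite_space:
  assumes h: "low_pass_filter h" "n > 0" and \<nu>: "is_line_measure \<nu>"
    and int: "\<And>j. integrable (variation \<nu>) (\<lambda>y. complex_of_real (hermite_fn j y) * f y)"
  shows "sigma_op h n \<nu> f \<in> hermite_space n"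
proof -
  have "sigma_op h n \<nu> f x = (\<Sum>j\<in>freq n.
      (complex_of_real (h (sqrt (real j) / n)) * line_integral \<nu> (\<lambda>y. complex_of_real (hermite_fn j y) * f y))
      * complex_of_real (hermite_fn j x))" for x
  proof -
    have "(\<lambda>y. complex_of_real (kernel h n x y) * f y) =
       (\<lambda>y. \<Sum>j\<in>freq n. complex_of_real (h (sqrt (real j) / n) * hermite_fn j x) * (complex_of_real (hermite_fn j y) * f y))"
      unfolding kernel_eq_freq_sum[OF h] by (simp add: sum_distrib_right mult.assoc)
    then show ?thesis
      unfolding sigma_op_def by (simp only: line_integral_sum[OF \<nu> finite_freq int]) (simp add: mult_ac)
  qed
  then show ?thesis unfolding hermite_space_iff by (intro exI ext)
qed

lemma sigma_op_diff:
  assumes h: "low_pass_filter h" "n > 0" and \<nu>: "is_line_measure \<nu>"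
    and "\<And>j. integrable (variation \<nu>) (\<lambda>y. complex_of_real (hermite_fn j y) * f y)"
    and "\<And>j. integrable (variation \<nu>) (\<lambda>y. complex_of_real (hermite_fn j y) * g y)"
  shows "sigma_op h n \<nu> (\<lambda>y. f y - g y) x = sigma_op h n \<nu> f x - sigma_op h n \<nu> g x"
  unfolding sigma_op_def right_diff_distrib
  by (rule line_integral_diff[OF \<nu> integrable_kernel_mult[OF h assms(4)] integrable_kernel_mult[OF h assms(5)]])

lemma cmod_sigma_op_le:
  assumes h: "low_pass_filter h" "n > 0" and \<nu>: "is_line_measure \<nu>"
    and int: "\<And>j. integrable (variation \<nu>) (\<lambda>y. complex_of_real (hermite_fn j y) * u y)"
    and C: "C \<ge> 0" "\<And>x y. \<bar>kernel h n x y\<bar> \<le> C * bump N (x - y)" and N: "N > 0"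
    and u: "u \<in> borel_measurable borel"
  shows "ennreal (cmod (sigma_op h n \<nu> u x)) \<le>
    ennreal (4 * C) * (\<integral>\<^sup>+y. ennreal (bump N (x - y) * cmod (u y)) \<partial>variation \<nu>)"
proof -
  have s[measurable_cong]: "sets (variation \<nu>) = sets borel" by (rule sets_variation) fact
  have "ennreal (cmod (sigma_op h n \<nu> u x)) \<le> 4 * (\<integral>\<^sup>+y. ennreal (cmod (complex_of_real (kernel h n x y) * u y)) \<partial>variation \<nu>)"
    unfolding sigma_op_def by (rule cmod_line_integral_le[OF \<nu> integrable_kernel_mult[OF h int]])
  also have "\<dots> \<le> 4 * (\<integral>\<^sup>+y. ennreal C * ennreal (bump N (x - y) * cmod (u y)) \<partial>variation \<nu>)"
  proof (intro mult_left_mono nn_integral_mono)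
    fix y
    have "\<bar>kernel h n x y\<bar> * cmod (u y) \<le> C * bump N (x - y) * cmod (u y)"
      by (rule mult_right_mono[OF C(2)]) simp
    then show "ennreal (cmod (complex_of_real (kernel h n x y) * u y)) \<le> ennreal C * ennreal (bump N (x - y) * cmod (u y))"
      using C(1) bump_nonneg[OF N] by (simp add: norm_mult ennreal_mult[symmetric] mult.assoc)
  qed simp
  also have "\<dots> = 4 * (ennreal C * (\<integral>\<^sup>+y. ennreal (bump N (x - y) * cmod (u y)) \<partial>variation \<nu>))"
  proof -
    have "(\<lambda>y. ennreal (bump N (x - y) * cmod (u y))) \<in> borel_measurable (variation \<nu>)"
      using u by measurable
    then show ?thesis by (simp only: nn_integral_cmult)
  qed
  finally show ?thesis using C(1) by (simp add: ennreal_mult mult.assoc)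
qed

section \<open>Lebesgue norm bounds\<close>

text \<open>If a > l, then (a / l) powr (r - 1) >= 1. The free parameter \<open>l\<close> is
  optimized only after integration.\<close>

lemma le_powr_interpolation:
  fixes a l r :: real
  assumes "a \<ge> 0" "l > 0" "r \<ge> 1"
  shows "a \<le> l + l powr (1 - r) * a powr r"
proof (cases "a \<le> l")
  case True
  moreover have "l powr (1 - r) * a powr r \<ge> 0" by simp
  ultimately show ?thesis by linarith
next
  case False
  then have a: "a > l" "a > 0" using assms by auto
  have "l powr (r - 1) \<le> a powr (r - 1)" using a assms by (intro powr_mono2) auto
  then have "l powr (1 - r) * l powr (r - 1) * a \<le> l powr (1 - r) * a powr (r - 1) * a"
    using a by (intro mult_right_mono mult_left_mono) auto
  also have "l powr (1 - r) * l powr (r - 1) = 1" using assms by (simp add: powr_add[symmetric])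
  also have "l powr (1 - r) * a powr (r - 1) * a = l powr (1 - r) * a powr r"
  proof -
    have "a powr (r - 1) * a = a powr r" using powr_add[of a "r - 1" 1] a by simp
    then show ?thesis by (simp only: mult.assoc)
  qed
  finally show ?thesis using assms(2) by simp
qed

text \<open>Jensen's inequality up to a constant, for a weight of arbitrary finite mass: integrate the
  preceding inequality against the weight and choose \<open>l\<close> to be the \<open>r\<close>-th root
  of the right-hand integral.\<close>

lemma powr_nn_integral_le:
  fixes k v :: "real \<Rightarrow> real" and V :: "real measure"
  assumes [measurable]: "k \<in> borel_measurable V" "v \<in> borel_measurable V"
    and k: "\<And>y. k y \<ge> 0" and v: "\<And>y. v y \<ge> 0" and r: "r \<ge> 1"
    and A: "(\<integral>\<^sup>+y. ennreal (k y) \<partial>V) \<le> ennreal A" "A \<ge> 0"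
    and c: "c > 0" and s: "s \<ge> 0" "ennreal s \<le> ennreal c * (\<integral>\<^sup>+y. ennreal (k y * v y) \<partial>V)"
  shows "ennreal (s powr r) \<le> ennreal ((c * (A + 1)) powr r) * (\<integral>\<^sup>+y. ennreal (k y * v y powr r) \<partial>V)"
proof -
  let ?B = "\<integral>\<^sup>+y. ennreal (k y * v y powr r) \<partial>V"
  have cA: "c * (A + 1) > 0" using A c by simp
  show ?thesis
  proof (cases "?B = \<infinity>")
    case True
    have "ennreal ((c * (A + 1)) powr r) \<noteq> 0" using c A(2) by simp
    then show ?thesis unfolding True by (simp add: ennreal_mult_top)
  next
    case False
    define \<beta> where "\<beta> = enn2real ?B"
    have \<beta>: "?B = ennreal \<beta>" "\<beta> \<ge> 0" using False by (simp_all add: \<beta>_def less_top)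
    \<comment> \<open>After integration the first term gives at most l A and the second at most l
      powr (1 - r) * l powr r = l.\<close>
    have *: "s \<le> c * (l * (A + 1))" if l: "l > 0" "\<beta> \<le> l powr r" for l
    proof -
      have "(\<integral>\<^sup>+y. ennreal (k y * v y) \<partial>V) \<le>
        (\<integral>\<^sup>+y. ennreal l * ennreal (k y) + ennreal (l powr (1 - r)) * ennreal (k y * v y powr r) \<partial>V)"
      proof (rule nn_integral_mono)
        fix y
        have "k y * v y \<le> k y * (l + l powr (1 - r) * v y powr r)"
          by (intro mult_left_mono le_powr_interpolation k v l r)
        also have "\<dots> = l * k y + l powr (1 - r) * (k y * v y powr r)" by (simp add: algebra_simps)
        finally have "ennreal (k y * v y) \<le> ennreal (l * k y + l powr (1 - r) * (k y * v y powr r))"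
          by (rule ennreal_leI)
        also have "\<dots> = ennreal l * ennreal (k y) + ennreal (l powr (1 - r)) * ennreal (k y * v y powr r)"
          using l k v by (simp add: ennreal_mult[symmetric])
        finally show "ennreal (k y * v y) \<le> \<dots>" .
      qed
      also have "\<dots> = ennreal l * (\<integral>\<^sup>+y. ennreal (k y) \<partial>V) + ennreal (l powr (1 - r)) * ?B"
        by (simp add: nn_integral_add nn_integral_cmult)
      also have "\<dots> \<le> ennreal l * ennreal A + ennreal (l powr (1 - r)) * ennreal (l powr r)"
        unfolding \<beta>(1) using l by (intro add_mono mult_left_mono A ennreal_leI) auto
      also have "\<dots> = ennreal (l * (A + 1))"
      proof -
        have "l powr (1 - r) * l powr r = l" using l by (simp add: powr_add[symmetric])
        then have "ennreal (l powr (1 - r)) * ennreal (l powr r) = ennreal l"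
          using ennreal_mult[of "l powr (1 - r)" "l powr r"] by simp
        then show ?thesis using l A(2) by (simp add: ennreal_mult[symmetric] distrib_left)
      qed
      finally have "ennreal s \<le> ennreal c * ennreal (l * (A + 1))"
        using s(2) by (meson mult_left_mono order_trans zero_le)
      then have "ennreal s \<le> ennreal (c * (l * (A + 1)))"
        using c l A(2) by (simp add: ennreal_mult[symmetric])
      then show ?thesis using c l A(2) by (subst (asm) ennreal_le_iff) auto
    qed
    have "s powr r \<le> (c * (A + 1)) powr r * \<beta>"
    proof (cases "\<beta> = 0")
      case True
      have "s \<le> 0"
      proof (rule ccontr)
        assume "\<not> s \<le> 0"
        \<comment> \<open>The root of \<beta> = 0 is not an admissible \<open>l\<close>; this small
          positive value yields s <= s / 2 instead.\<close>
        define l where "l = s / (2 * (c * (A + 1)))"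
        have "l > 0" using \<open>\<not> s \<le> 0\<close> cA by (simp add: l_def)
        then have "s \<le> c * (l * (A + 1))" using * True by simp
        also have "\<dots> = l * (c * (A + 1))" by simp
        also have "\<dots> = s / 2"
        proof -
          have "s / (2 * d) * d = s / 2" if "d > 0" for d using that by simp
          from this[OF cA] show ?thesis unfolding l_def .
        qed
        finally show False using \<open>\<not> s \<le> 0\<close> by simp
      qed
      then show ?thesis using s(1) True by simp
    next
      case False
      define l where "l = \<beta> powr (1 / r)"
      have l: "l > 0" "l powr r = \<beta>" using False \<beta>(2) r by (simp_all add: l_def powr_powr)
      then have "s \<le> c * (A + 1) * l" using *[of l] by (simp add: mult_ac)
      then have "s powr r \<le> (c * (A + 1) * l) powr r" using s(1) r by (intro powr_mono2) auto
      also have "\<dots> = (c * (A + 1)) powr r * \<beta>" using cA l by (simp add: powr_mult)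
      finally show ?thesis .
    qed
    then have "ennreal (s powr r) \<le> ennreal ((c * (A + 1)) powr r * \<beta>)" by (rule ennreal_leI)
    then show ?thesis unfolding \<beta>(1) using \<beta>(2) by (simp add: ennreal_mult)
  qed
qed

text \<open>The pointwise Jensen-type bound uses the mass of the weight in y against V. After
  Fubini's theorem the inner integral in x is the Lebesgue mass of the even function
  \<open>bump N\<close>, at most 32.\<close>

lemma schur_test_powr:
  fixes v s :: "real \<Rightarrow> real"
  assumes V: "sets V = sets borel" "sigma_finite_measure V"
    and [measurable]: "v \<in> borel_measurable borel" and v: "\<And>y. v y \<ge> 0"
    and r: "r \<ge> 1" and N: "N > 0"
    and A: "\<And>x. (\<integral>\<^sup>+y. ennreal (bump N (x - y)) \<partial>V) \<le> ennreal A" "A \<ge> 0"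
    and c: "c > 0" and s: "\<And>x. s x \<ge> 0"
      "\<And>x. ennreal (s x) \<le> ennreal c * (\<integral>\<^sup>+y. ennreal (bump N (x - y) * v y) \<partial>V)"
  shows "(\<integral>\<^sup>+x. ennreal (s x powr r) \<partial>lborel) \<le>
    ennreal (32 * (c * (A + 1)) powr r) * (\<integral>\<^sup>+y. ennreal (v y powr r) \<partial>V)"
proof -
  note [measurable_cong] = V(1)
  interpret sigma_finite_measure V by fact
  interpret pair_sigma_finite V lborel by standard
  let ?D = "ennreal ((c * (A + 1)) powr r)"
  have "(\<integral>\<^sup>+x. ennreal (s x powr r) \<partial>lborel) \<le>
      (\<integral>\<^sup>+x. ?D * (\<integral>\<^sup>+y. ennreal (bump N (x - y) * v y powr r) \<partial>V) \<partial>lborel)"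
    by (intro nn_integral_mono powr_nn_integral_le A c s r v bump_nonneg N) measurable
  also have "\<dots> = ?D * (\<integral>\<^sup>+x. (\<integral>\<^sup>+y. ennreal (bump N (x - y) * v y powr r) \<partial>V) \<partial>lborel)"
    by (rule nn_integral_cmult) measurable
  also have "(\<integral>\<^sup>+x. (\<integral>\<^sup>+y. ennreal (bump N (x - y) * v y powr r) \<partial>V) \<partial>lborel) =
      (\<integral>\<^sup>+y. (\<integral>\<^sup>+x. ennreal (bump N (x - y) * v y powr r) \<partial>lborel) \<partial>V)"
    by (rule Fubini') measurable
  also have "\<dots> = (\<integral>\<^sup>+y. ennreal (v y powr r) * (\<integral>\<^sup>+x. ennreal (bump N (y - x)) \<partial>lborel) \<partial>V)"
  proof (intro nn_integral_cong)
    fix y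
    have "(\<integral>\<^sup>+x. ennreal (bump N (x - y) * v y powr r) \<partial>lborel) =
        (\<integral>\<^sup>+x. ennreal (v y powr r) * ennreal (bump N (y - x)) \<partial>lborel)"
      using bump_nonneg[OF N] by (intro nn_integral_cong)
        (simp add: ennreal_mult[symmetric] mult.commute bump_def abs_minus_commute)
    also have "\<dots> = ennreal (v y powr r) * (\<integral>\<^sup>+x. ennreal (bump N (y - x)) \<partial>lborel)"
      by (rule nn_integral_cmult) measurable
    finally show "(\<integral>\<^sup>+x. ennreal (bump N (x - y) * v y powr r) \<partial>lborel) = \<dots>" .
  qed
  also have "\<dots> \<le> (\<integral>\<^sup>+y. ennreal (v y powr r) * 32 \<partial>V)"
    by (intro nn_integral_mono mult_left_mono nn_integral_bump_lborel_le N) simp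
  also have "\<dots> = (\<integral>\<^sup>+y. ennreal (v y powr r) \<partial>V) * 32"
    by (rule nn_integral_multc) measurable
  finally have "(\<integral>\<^sup>+x. ennreal (s x powr r) \<partial>lborel) \<le> ?D * ((\<integral>\<^sup>+y. ennreal (v y powr r) \<partial>V) * 32)"
    by (simp add: mult_left_mono)
  also have "\<dots> = ennreal (32 * (c * (A + 1)) powr r) * (\<integral>\<^sup>+y. ennreal (v y powr r) \<partial>V)"
    by (simp add: ennreal_mult mult_ac)
  finally show ?thesis .
qed

section \<open>Norm inequalities in integral form and the operator bound\<close>

lemma Lp_norm_le_iff:
  assumes p: "p \<noteq> \<infinity>" "enn2real p > 0" and a: "a \<ge> 0"
  shows "Lp_norm M p f \<le> ennreal a \<longleftrightarrow>
    (\<integral>\<^sup>+x. ennreal (cmod (f x) powr enn2real p) \<partial>M) \<le> ennreal (a powr enn2real p)"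
proof -
  define r where "r = enn2real p"
  have r: "r > 0" using p by (simp add: r_def)
  let ?I = "\<integral>\<^sup>+x. ennreal (cmod (f x) powr r) \<partial>M"
  show ?thesis unfolding r_def[symmetric]
  proof (cases "?I = \<infinity>")
    case True
    then show "Lp_norm M p f \<le> ennreal a \<longleftrightarrow> ?I \<le> ennreal (a powr r)"
      using p by (simp add: Lp_norm_def r_def top_unique)
  next
    case False
    then obtain i where i: "?I = ennreal i" "i \<ge> 0" by (cases ?I) auto
    then have "Lp_norm M p f = ennreal (i powr (1 / r))"
      using p by (simp add: Lp_norm_def r_def)
    moreover have "i powr (1 / r) \<le> a \<longleftrightarrow> i \<le> a powr r"
    proof
      assume "i powr (1 / r) \<le> a"
      then have "(i powr (1 / r)) powr r \<le> a powr r" using r by (intro powr_mono2) auto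
      then show "i \<le> a powr r" using r i(2) by (simp add: powr_powr)
    next
      assume "i \<le> a powr r"
      then have "i powr (1 / r) \<le> (a powr r) powr (1 / r)" using r i(2) by (intro powr_mono2) auto
      then show "i powr (1 / r) \<le> a" using r a by (simp add: powr_powr)
    qed
    ultimately show "Lp_norm M p f \<le> ennreal a \<longleftrightarrow> ?I \<le> ennreal (a powr r)"
      unfolding i(1) using a by (simp add: ennreal_le_iff)
  qed
qed

lemma Lp_norm_infinity_le_iff:
  assumes "f \<in> borel_measurable M" "a \<ge> 0"
  shows "Lp_norm M \<infinity> f \<le> ennreal a \<longleftrightarrow> (AE x in M. cmod (f x) \<le> a)"
proof
  assume *: "Lp_norm M \<infinity> f \<le> ennreal a"
  have "AE x in M. ennreal (cmod (f x)) \<le> esssup M (\<lambda>x. ennreal (cmod (f x)))" by (rule esssup_AE)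
  then show "AE x in M. cmod (f x) \<le> a"
  proof eventually_elim
    case (elim x)
    also have "esssup M (\<lambda>x. ennreal (cmod (f x))) \<le> ennreal a" using * by (simp add: Lp_norm_def)
    finally show ?case using assms(2) by simp
  qed
next
  assume *: "AE x in M. cmod (f x) \<le> a"
  have "esssup M (\<lambda>x. ennreal (cmod (f x))) \<le> ennreal a"
  proof (rule esssup_I)
    show "(\<lambda>x. ennreal (cmod (f x))) \<in> borel_measurable M" using assms(1) by measurable
    show "AE x in M. ennreal (cmod (f x)) \<le> ennreal a" using * by eventually_elim (rule ennreal_leI)
  qed
  then show "Lp_norm M \<infinity> f \<le> ennreal a" by (simp add: Lp_norm_def)
qed

text \<open>From s + t <= 2 max s t; the constant \<open>2 powr r\<close> ends up in c.\<close>

lemma powr_add_le: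
  fixes s t r :: real
  assumes "s \<ge> 0" "t \<ge> 0" "r > 0"
  shows "(s + t) powr r \<le> 2 powr r * (s powr r + t powr r)"
proof -
  have "(s + t) powr r \<le> (2 * max s t) powr r" using assms by (intro powr_mono2) auto
  also have "\<dots> = 2 powr r * max s t powr r" using assms by (simp add: powr_mult)
  also have "\<dots> \<le> 2 powr r * (s powr r + t powr r)"
    by (intro mult_left_mono) (auto simp: max_def)
  finally show ?thesis .
qed

text \<open>Here \<open>w\<close> stands for the operator applied to \<open>u\<close>. Schur's test
  passes from the variation to Lebesgue measure with the constant \<open>D\<close>, hypothesis
  \<open>V\<close> bounds the norm over the variation at the price of K, and the subtracted
  \<open>u\<close> contributes the 1.\<close>

lemma sigma_op_Lp_bound_finite:
  assumes \<nu>: "is_line_measure \<nu>" "N > 0" "growth_norm N \<nu> \<le> ennreal M" "M \<ge> 0"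
    and u[measurable]: "u \<in> borel_measurable borel" "w \<in> borel_measurable borel"
    and p: "p \<noteq> \<infinity>" "enn2real p \<ge> 1" and C: "C > 0" and K: "K \<ge> 0" and a: "a \<ge> 0"
    and w: "\<And>x. ennreal (cmod (w x)) \<le> ennreal C * (\<integral>\<^sup>+y. ennreal (bump N (x - y) * cmod (u y)) \<partial>variation \<nu>)"
    and V: "Lp_norm (variation \<nu>) p u \<le> ennreal (K * a)" and L: "Lp_norm lborel p u \<le> ennreal a"
  defines "r \<equiv> enn2real p"
  shows "Lp_norm lborel p (\<lambda>x. w x - u x) \<le>
    ennreal ((2 powr r * (32 * (C * (16 * M + 1)) powr r * K powr r + 1)) powr (1 / r) * a)"
proof -
  have r: "r \<ge> 1" "r > 0" using p by (simp_all add: r_def)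
  define D where "D = 32 * (C * (16 * M + 1)) powr r"
  have D: "D \<ge> 0" by (simp add: D_def)
  define E where "E = 2 powr r * (D * K powr r + 1)"
  have E: "E \<ge> 0" using D by (simp add: E_def)
  have s: "sets (variation \<nu>) = sets borel" by (rule sets_variation) fact
  have sf: "sigma_finite_measure (variation \<nu>)"
    by (rule sigma_finite_variation[OF \<nu>(1,2)]) (use \<nu>(3) in \<open>auto simp: le_less_trans\<close>)
  have "(\<integral>\<^sup>+x. ennreal (cmod (w x) powr r) \<partial>lborel) \<le>
     ennreal D * (\<integral>\<^sup>+y. ennreal (cmod (u y) powr r) \<partial>variation \<nu>)"
    unfolding D_def
    by (rule schur_test_powr[OF s sf, where N = N])
       (use r \<nu> C w in \<open>auto intro: nn_integral_bump_variation_le\<close>)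
  also have "(\<integral>\<^sup>+y. ennreal (cmod (u y) powr r) \<partial>variation \<nu>) \<le> ennreal ((K * a) powr r)"
    using V K a p r unfolding r_def by (subst (asm) Lp_norm_le_iff) auto
  finally have 1: "(\<integral>\<^sup>+x. ennreal (cmod (w x) powr r) \<partial>lborel) \<le> ennreal D * ennreal ((K * a) powr r)"
    by (simp add: mult_left_mono)
  have 2: "(\<integral>\<^sup>+x. ennreal (cmod (u x) powr r) \<partial>lborel) \<le> ennreal (a powr r)"
    using L a p r unfolding r_def by (subst (asm) Lp_norm_le_iff) auto
  have "(\<integral>\<^sup>+x. ennreal (cmod (w x - u x) powr r) \<partial>lborel) \<le>
     (\<integral>\<^sup>+x. ennreal (2 powr r) * (ennreal (cmod (w x) powr r) + ennreal (cmod (u x) powr r)) \<partial>lborel)"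
  proof (rule nn_integral_mono)
    fix x
    have "cmod (w x - u x) powr r \<le> (cmod (w x) + cmod (u x)) powr r"
      using r by (intro powr_mono2 norm_triangle_ineq4) auto
    also have "\<dots> \<le> 2 powr r * (cmod (w x) powr r + cmod (u x) powr r)"
      using r by (intro powr_add_le) auto
    finally have "ennreal (cmod (w x - u x) powr r) \<le> \<dots>" by (rule ennreal_leI)
    then show "ennreal (cmod (w x - u x) powr r) \<le> ennreal (2 powr r) * (ennreal (cmod (w x) powr r) + ennreal (cmod (u x) powr r))"
      by (simp add: ennreal_mult)
  qed
  also have "\<dots> = ennreal (2 powr r) * ((\<integral>\<^sup>+x. ennreal (cmod (w x) powr r) \<partial>lborel) + (\<integral>\<^sup>+x. ennreal (cmod (u x) powr r) \<partial>lborel))"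
    by (simp add: nn_integral_cmult nn_integral_add)
  also have "\<dots> \<le> ennreal (2 powr r) * (ennreal D * ennreal ((K * a) powr r) + ennreal (a powr r))"
    by (intro mult_left_mono add_mono 1 2) simp
  also have "\<dots> = ennreal (2 powr r * (D * (K * a) powr r + a powr r))"
    using D by (simp add: ennreal_mult)
  also have "2 powr r * (D * (K * a) powr r + a powr r) = (E powr (1 / r) * a) powr r"
    using E a K r by (simp add: powr_mult powr_powr E_def algebra_simps)
  finally show ?thesis
    unfolding D_def[symmetric] E_def[symmetric]
    using p r a unfolding r_def by (subst Lp_norm_le_iff) auto
qed

text \<open>Two kinds of null sets occur. The bound for \<open>w\<close> holds everywhere, by
  integrating a bound for \<open>u\<close> that holds almost everywhere for the variation; the
  subtracted \<open>u\<close> is bounded almost everywhere for Lebesgue measure.\<close>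

lemma sigma_op_Lp_bound_infinity:
  assumes \<nu>: "is_line_measure \<nu>" "N > 0" "growth_norm N \<nu> \<le> ennreal M" "M \<ge> 0"
    and u[measurable]: "u \<in> borel_measurable borel" "w \<in> borel_measurable borel"
    and C: "C > 0" and K: "K \<ge> 0" and a: "a \<ge> 0"
    and w: "\<And>x. ennreal (cmod (w x)) \<le> ennreal C * (\<integral>\<^sup>+y. ennreal (bump N (x - y) * cmod (u y)) \<partial>variation \<nu>)"
    and V: "Lp_norm (variation \<nu>) \<infinity> u \<le> ennreal (K * a)" and L: "Lp_norm lborel \<infinity> u \<le> ennreal a"
  shows "Lp_norm lborel \<infinity> (\<lambda>x. w x - u x) \<le> ennreal ((C * (16 * M) * K + 1) * a)"
proof -
  have s[measurable_cong]: "sets (variation \<nu>) = sets borel" by (rule sets_variation) fact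
  have "u \<in> borel_measurable (variation \<nu>)" by measurable
  then have uV: "AE y in variation \<nu>. cmod (u y) \<le> K * a"
    using V K a by (subst (asm) Lp_norm_infinity_le_iff) auto
  have uL: "AE y in lborel. cmod (u y) \<le> a"
    using L a by (subst (asm) Lp_norm_infinity_le_iff) auto
  have wb: "cmod (w x) \<le> C * (16 * M) * K * a" for x
  proof -
    have "(\<integral>\<^sup>+y. ennreal (bump N (x - y) * cmod (u y)) \<partial>variation \<nu>) \<le>
        (\<integral>\<^sup>+y. ennreal (K * a) * ennreal (bump N (x - y)) \<partial>variation \<nu>)"
    proof (rule nn_integral_mono_AE)
      show "AE y in variation \<nu>. ennreal (bump N (x - y) * cmod (u y)) \<le> ennreal (K * a) * ennreal (bump N (x - y))"
        using uV
      proof eventually_elim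
        case (elim y)
        then have "bump N (x - y) * cmod (u y) \<le> bump N (x - y) * (K * a)"
          by (rule mult_left_mono) (rule bump_nonneg[OF \<nu>(2)])
        then show ?case using K a bump_nonneg[OF \<nu>(2), of "x - y"]
          by (subst ennreal_mult[symmetric]) (auto simp: mult.commute intro!: ennreal_leI)
      qed
    qed
    also have "\<dots> = ennreal (K * a) * (\<integral>\<^sup>+y. ennreal (bump N (x - y)) \<partial>variation \<nu>)"
      by (rule nn_integral_cmult) measurable
    also have "\<dots> \<le> ennreal (K * a) * ennreal (16 * M)"
      by (intro mult_left_mono nn_integral_bump_variation_le \<nu>) simp
    finally have "ennreal (cmod (w x)) \<le> ennreal C * (ennreal (K * a) * ennreal (16 * M))"
      using w[of x] by (meson mult_left_mono order_trans zero_le)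
    also have "\<dots> = ennreal (C * ((K * a) * (16 * M)))"
      using C K a \<nu>(4) by (simp add: ennreal_mult)
    finally have "ennreal (cmod (w x)) \<le> ennreal (C * (16 * M) * K * a)" by (simp add: mult_ac)
    then show ?thesis using C K a \<nu>(4) by (subst (asm) ennreal_le_iff) auto
  qed
  have "AE x in lborel. cmod (w x - u x) \<le> (C * (16 * M) * K + 1) * a"
    using uL
  proof eventually_elim
    case (elim x)
    then show ?case using wb[of x] norm_triangle_ineq4[of "w x" "u x"] by (simp add: distrib_right)
  qed
  then show ?thesis using C K a \<nu>(4) by (subst Lp_norm_infinity_le_iff) auto
qed

text \<open>The order of quantifiers is the point: c is fixed by h, p, M and K before n, the measure
  and the function are chosen.\<close>

lemma sigma_op_Lp_bound:
  fixes M K :: real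
  assumes h: "low_pass_filter h" and p: "p \<ge> 1"
  obtains c where "c > 0"
    "\<And>n \<nu> u. \<lbrakk>n > 0; is_line_measure \<nu>; growth_norm (max 1 n) \<nu> \<le> ennreal M; u \<in> borel_measurable borel;
       \<And>j. integrable (variation \<nu>) (\<lambda>y. complex_of_real (hermite_fn j y) * u y);
       Lp_norm (variation \<nu>) p u \<le> ennreal K * Lp_norm lborel p u\<rbrakk> \<Longrightarrow>
       Lp_norm lborel p (\<lambda>x. sigma_op h n \<nu> u x - u x) \<le> ennreal c * Lp_norm lborel p u"
proof -
  obtain C where C: "C > 0" "\<And>n x y. n > 0 \<Longrightarrow> \<bar>kernel h n x y\<bar> \<le> C * bump (max 1 n) (x - y)"
    using kernel_bound[OF h] by metis
  \<comment> \<open>\<open>ennreal\<close> sends negative reals to 0, so truncation at 0 leaves the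
    hypotheses unchanged and makes the constants nonnegative.\<close>
  define M' where "M' = max 0 M"
  define K' where "K' = max 0 K"
  have M': "M' \<ge> 0" "ennreal M = ennreal M'" and K': "K' \<ge> 0" "ennreal K = ennreal K'"
    by (auto simp: M'_def K'_def max_def ennreal_neg)
  define r where "r = enn2real p"
  define c where "c = (if p = \<infinity> then 4 * C * (16 * M') * K' + 1
    else (2 powr r * (32 * (4 * C * (16 * M' + 1)) powr r * K' powr r + 1)) powr (1 / r))"
  have c: "c > 0"
  proof -
    have "4 * C * (16 * M') * K' + 1 > 0" using C(1) M' K' by (intro add_nonneg_pos) auto
    moreover have "2 powr r * (32 * (4 * C * (16 * M' + 1)) powr r * K' powr r + 1) > 0"
      by (intro mult_pos_pos add_nonneg_pos) auto
    then have "(2 powr r * (32 * (4 * C * (16 * M' + 1)) powr r * K' powr r + 1)) powr (1 / r) > 0"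
      by (subst powr_gt_zero) (rule less_imp_neq[THEN not_sym])
    ultimately show ?thesis unfolding c_def by (simp only: split: if_split) blast
  qed
  show ?thesis
  proof (rule that[OF c])
    fix n \<nu> u
    assume n: "n > 0" and \<nu>: "is_line_measure \<nu>" "growth_norm (max 1 n) \<nu> \<le> ennreal M"
      and u: "u \<in> borel_measurable borel"
      and int: "\<And>j. integrable (variation \<nu>) (\<lambda>y. complex_of_real (hermite_fn j y) * u y)"
      and V: "Lp_norm (variation \<nu>) p u \<le> ennreal K * Lp_norm lborel p u"
    let ?N = "max 1 n"
    have N: "?N > 0" by simp
    have w: "ennreal (cmod (sigma_op h n \<nu> u x)) \<le>
      ennreal (4 * C) * (\<integral>\<^sup>+y. ennreal (bump ?N (x - y) * cmod (u y)) \<partial>variation \<nu>)" for x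
      by (rule cmod_sigma_op_le[OF h n \<nu>(1) int _ C(2)[OF n] N u]) (use C(1) in simp)
    have wm: "sigma_op h n \<nu> u \<in> borel_measurable borel"
      by (rule hermite_space_measurable[OF sigma_op_in_hermite_space[OF h n \<nu>(1) int]])
    have g: "growth_norm ?N \<nu> \<le> ennreal M'" using \<nu>(2) M'(2) by simp
    have C4: "4 * C > 0" using C(1) by simp
    show "Lp_norm lborel p (\<lambda>x. sigma_op h n \<nu> u x - u x) \<le> ennreal c * Lp_norm lborel p u"
    proof (cases "Lp_norm lborel p u")
      case top
      then show ?thesis using c by (simp add: ennreal_mult_top)
    next
      case (real a)
      have V': "Lp_norm (variation \<nu>) p u \<le> ennreal (K' * a)"
        using V unfolding real K'(2) using K'(1) real(1) by (simp add: ennreal_mult)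
      have L: "Lp_norm lborel p u \<le> ennreal a" using real by simp
      have "Lp_norm lborel p (\<lambda>x. sigma_op h n \<nu> u x - u x) \<le> ennreal (c * a)"
      proof (cases "p = \<infinity>")
        case True
        show ?thesis
          using sigma_op_Lp_bound_infinity[OF \<nu>(1) N g M'(1) u wm C4 K'(1) real(1) w] V' L
          unfolding True c_def by simp
      next
        case False
        then obtain q where q: "p = ennreal q" "q \<ge> 0" by (cases p) auto
        have "enn2real p \<ge> 1" using p q by simp
        then show ?thesis
          using sigma_op_Lp_bound_finite[OF \<nu>(1) N g M'(1) u wm False _ C4 K'(1) real(1) w V' L] False
          unfolding c_def r_def by simp
      qed
      then show ?thesis unfolding real using c real(1) by (simp add: ennreal_mult)
    qed
  qed
qed

theorem theorem6:
  fixes h :: "real \<Rightarrow> real"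
  assumes "low_pass_filter h"
  shows
    "(\<forall>n>0. \<forall>\<nu>\<in>MZ n. \<forall>P\<in>hermite_space (n/2). sigma_op h n \<nu> P = P)
     \<and> (\<forall>p\<ge>1. \<forall>M K. \<exists>c>0. \<forall>n>0. \<forall>\<nu>\<in>MZ n. \<forall>f \<in> Lp_space lborel p \<inter> sigma_domain \<nu>.
          approx_error n p f \<le> Lp_norm lborel p (\<lambda>x. sigma_op h n \<nu> f x - f x)
          \<and> (growth_norm (max 1 n) \<nu> \<le> ennreal M \<and> norm_controlled K (n/2) \<nu> p f \<longrightarrow>
               Lp_norm lborel p (\<lambda>x. sigma_op h n \<nu> f x - f x)
                 \<le> ennreal c * approx_error (n/2) p f))"
proof (intro conjI allI impI ballI)
  fix n :: real and \<nu> P assume "n > 0" "\<nu> \<in> MZ n" "P \<in> hermite_space (n/2)"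
  then show "sigma_op h n \<nu> P = P" by (rule sigma_op_reproducing[OF assms])
next
  fix p :: ennreal and M K :: real assume p: "p \<ge> 1"
  obtain c where c: "c > 0"
    "\<And>n \<nu> u. \<lbrakk>n > 0; is_line_measure \<nu>; growth_norm (max 1 n) \<nu> \<le> ennreal M; u \<in> borel_measurable borel;
       \<And>j. integrable (variation \<nu>) (\<lambda>y. complex_of_real (hermite_fn j y) * u y);
       Lp_norm (variation \<nu>) p u \<le> ennreal K * Lp_norm lborel p u\<rbrakk> \<Longrightarrow>
       Lp_norm lborel p (\<lambda>x. sigma_op h n \<nu> u x - u x) \<le> ennreal c * Lp_norm lborel p u"
    using sigma_op_Lp_bound[OF assms p] by blast
  show "\<exists>c>0. \<forall>n>0. \<forall>\<nu>\<in>MZ n. \<forall>f \<in> Lp_space lborel p \<inter> sigma_domain \<nu>.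
          approx_error n p f \<le> Lp_norm lborel p (\<lambda>x. sigma_op h n \<nu> f x - f x)
          \<and> (growth_norm (max 1 n) \<nu> \<le> ennreal M \<and> norm_controlled K (n/2) \<nu> p f \<longrightarrow>
               Lp_norm lborel p (\<lambda>x. sigma_op h n \<nu> f x - f x)
                 \<le> ennreal c * approx_error (n/2) p f)"
  proof (intro exI[of _ c] conjI c(1) allI ballI impI)
    fix n :: real and \<nu> f
    assume n: "n > 0" and MZ: "\<nu> \<in> MZ n" and f: "f \<in> Lp_space lborel p \<inter> sigma_domain \<nu>"
    have \<nu>: "is_line_measure \<nu>" "growth_norm n \<nu> < \<infinity>" using MZ by (auto simp: MZ_def growth_class_def)
    have fm: "f \<in> borel_measurable borel" using f by (simp add: Lp_space_def)
    have fint: "integrable (variation \<nu>) (\<lambda>y. complex_of_real (hermite_fn j y) * f y)" for j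
      using integrable_hermite_fn_sigma_domain[OF \<nu>(1) n \<nu>(2)] f by blast
    show "approx_error n p f \<le> Lp_norm lborel p (\<lambda>x. sigma_op h n \<nu> f x - f x)"
    proof -
      have "approx_error n p f \<le> Lp_norm lborel p (\<lambda>x. f x - sigma_op h n \<nu> f x)"
        unfolding approx_error_def
        by (rule INF_lower[OF sigma_op_in_hermite_space[OF assms n \<nu>(1) fint]])
      also have "\<dots> = Lp_norm lborel p (\<lambda>x. sigma_op h n \<nu> f x - f x)"
        by (simp add: Lp_norm_def norm_minus_commute)
      finally show ?thesis .
    qed
    assume "growth_norm (max 1 n) \<nu> \<le> ennreal M \<and> norm_controlled K (n/2) \<nu> p f"
    then have g: "growth_norm (max 1 n) \<nu> \<le> ennreal M" and nc: "norm_controlled K (n/2) \<nu> p f" by auto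
    let ?X = "Lp_norm lborel p (\<lambda>x. sigma_op h n \<nu> f x - f x)"
    have X: "?X \<le> ennreal c * Lp_norm lborel p (\<lambda>x. f x - Q x)" if Q: "Q \<in> hermite_space (n/2)" for Q
    proof -
      have Qm: "Q \<in> borel_measurable borel" by (rule hermite_space_measurable[OF Q])
      obtain B where B: "\<And>x. cmod (Q x) \<le> B" using hermite_space_bounded[OF Q] by blast
      have Qint: "integrable (variation \<nu>) (\<lambda>y. complex_of_real (hermite_fn j y) * Q y)" for j
        by (rule integrable_hermite_fn_variation[OF \<nu>(1) n \<nu>(2) Qm, of B]) (simp add: B)
      let ?u = "\<lambda>x. f x - Q x"
      have "sigma_op h n \<nu> ?u x - ?u x = sigma_op h n \<nu> f x - f x" for x
        using sigma_op_diff[OF assms n \<nu>(1) fint Qint, of x] sigma_op_reproducing[OF assms n MZ Q] by simp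
      then have "?X = Lp_norm lborel p (\<lambda>x. sigma_op h n \<nu> ?u x - ?u x)" by (simp only:)
      also have "\<dots> \<le> ennreal c * Lp_norm lborel p ?u"
      proof (rule c(2)[OF n \<nu>(1) g])
        show "?u \<in> borel_measurable borel" using fm Qm by measurable
        show "integrable (variation \<nu>) (\<lambda>y. complex_of_real (hermite_fn j y) * ?u y)" for j
          unfolding right_diff_distrib by (rule Bochner_Integration.integrable_diff[OF fint Qint])
        \<comment> \<open>\<open>norm_controlled\<close> is stated for exactly these differences f -
          Q, with Q of order n / 2.\<close>
        show "Lp_norm (variation \<nu>) p ?u \<le> ennreal K * Lp_norm lborel p ?u"
          using nc Q unfolding norm_controlled_def by blast
      qed
      finally show ?thesis .
    qed
    \<comment> \<open>The infimum need not be attained, so the estimate is divided by c, passed to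
      the infimum as a lower bound for all Q, and multiplied back.\<close>
    have "?X / ennreal c \<le> approx_error (n/2) p f"
      unfolding approx_error_def
    proof (rule INF_greatest)
      fix Q assume "Q \<in> hermite_space (n/2)"
      then show "?X / ennreal c \<le> Lp_norm lborel p (\<lambda>x. f x - Q x)"
        using X c(1) by (intro divide_le_posI_ennreal) (auto simp: mult.commute)
    qed
    then have "ennreal c * (?X / ennreal c) \<le> ennreal c * approx_error (n/2) p f"
      by (rule mult_left_mono) simp
    moreover have "ennreal c * (?X / ennreal c) = ?X"
      using c(1) by (subst mult.commute, subst ennreal_divide_times) simp
    ultimately show "?X \<le> ennreal c * approx_error (n/2) p f" by simp
  qed
qed

end
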